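(* Let $\varepsilon>0$, let $A\subseteq\mathbb{R}^2$ be a nonempty bounded $2\varepsilon$-chained set, and let $D$ be a connected component of the subspace $\mathbb{R}^2\setminus \mathsf{B}_\varepsilon(A)$. Then the boundary $\partial D$ of $D$ in $\mathbb{R}^2$ is a simple closed curve, $\partial D\subseteq \mathsf{S}_\varepsilon(A)$, and moreover: if $D$ is bounded then $D=(\partial D)^-$, and if $D$ is unbounded then $D=(\partial D)^+$.
   Context: $\rho$ denotes Euclidean distance; for sets $X,Y\subseteq\mathbb{R}^2$, $\rho(X,Y)=\inf\{\rho(x,y):x\in X,y\in Y\}$ and $\rho(p,X)=\rho(\{p\},X)$. For $\varepsilon>0$ and $A\subseteq\mathbb{R}^2$: $\mathsf{B}_\varepsilon(A)=\{p\in\mathbb{R}^2:\rho(p,A)\le\varepsilon\}$ (closed $\varepsilon$-neighbourhood) and $\mathsf{S}_\varepsilon(A)=\{p\in\mathbb{R}^2:\rho(p,A)=\varepsilon\}$ (the $\varepsilon$-boundary). A set $A$ is $\delta$-chained ($\delta>0$) if for any $p,q\in A$ there are points $r_0=p,r_1,\dots,r_n=q$ in $A$ with $\rho(r_i,r_{i+1})<\delta$ for all $i<n$. A simple closed curve is a subset homeomorphic to a circle; for a simple closed curve $C\subseteq\mathbb{R}^2$, $C^-$ and $C^+$ denote the bounded and the unbounded component of $\mathbb{R}^2\setminus C$, respectively. *)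

theory Defs
  imports "HOL-Analysis.Analysis"
begin

text \<open>The plane R^2 is modelled by the type complex (Euclidean metric).
  rho(p,A) is infdist p A.\<close>

definition nbhd_closed :: "real \<Rightarrow> complex set \<Rightarrow> complex set" where
  "nbhd_closed e A = {p. infdist p A \<le> e}"

definition eps_boundary :: "real \<Rightarrow> complex set \<Rightarrow> complex set" where
  "eps_boundary e A = {p. infdist p A = e}"

definition delta_chained :: "real \<Rightarrow> complex set \<Rightarrow> bool" where
  "delta_chained d A \<longleftrightarrow>
     (\<forall>p\<in>A. \<forall>q\<in>A. \<exists>r::nat \<Rightarrow> complex. \<exists>n.
        r 0 = p \<and> r n = q \<and> (\<forall>i\<le>n. r i \<in> A) \<and> (\<forall>i<n. dist (r i) (r (Suc i)) < d))"

definition simple_closed_curve :: "complex set \<Rightarrow> bool" where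
  "simple_closed_curve C \<longleftrightarrow> C homeomorphic (sphere (0::complex) 1)"

definition inner_comp :: "complex set \<Rightarrow> complex set" where
  "inner_comp C = (THE U. U \<in> components (- C) \<and> bounded U)"

definition outer_comp :: "complex set \<Rightarrow> complex set" where
  "outer_comp C = (THE U. U \<in> components (- C) \<and> \<not> bounded U)"

end

theory Submission
  imports Defs
begin

text \<open>
  Let \<open>K\<close> be the closure of \<open>A\<close> and let \<open>U\<close> be the union of the open \<open>e\<close>-balls around \<open>A\<close>, which is connected
  because \<open>A\<close> is \<open>2e\<close>-chained. The frontier \<open>S\<close> of \<open>D\<close> separates \<open>D\<close> from \<open>U\<close> and lies in the closure of both,
  so no proper closed subset of \<open>S\<close> separates them; by Janiszewski's theorem \<open>S\<close> is connected and has no cut point.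

  \<open>S\<close> is locally path connected. Let \<open>p \<in> S\<close>. If the points of \<open>K\<close> nearest to \<open>p\<close> lie in an open half plane
  through \<open>p\<close>, then near \<open>p\<close> the set \<open>D\<close> is the part of a box below the graph of a continuous function. Otherwise two
  nearest points are antipodal, and on each side of the line joining them on which \<open>D\<close> accumulates at \<open>p\<close>, the
  set \<open>D\<close> is a cusp between two graphs that meet at \<open>p\<close>.

  Consequently \<open>S\<close> contains a simple closed curve \<open>C\<close>. Every point of \<open>S\<close> is accessible from \<open>U\<close> along a radius, so
  two points of \<open>C\<close> can be joined through \<open>U\<close>, and Janiszewski's theorem applied to the resulting theta curve shows
  that \<open>C\<close> separates \<open>D\<close> from \<open>U\<close>. Hence \<open>S = C\<close>.
\<close>

section \<open>Common boundaries of two plane domains\<close>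

text \<open>The purely topological half of the argument. Later \<open>D\<close> is the component,
  \<open>U\<close> the open \<open>e\<close>-neighbourhood of \<open>A\<close>, and \<open>S\<close>
  the frontier of \<open>D\<close>.\<close>

locale common_boundary =
  fixes D U S :: "complex set"
  assumes connected_D: "connected D" and nonempty_D: "D \<noteq> {}" and disjoint_D: "D \<inter> S = {}"
    and connected_U: "connected U" and nonempty_U: "U \<noteq> {}" and disjoint_U: "U \<inter> S = {}"
    and compact_S: "compact S"
    and closure_D: "S \<subseteq> closure D" and closure_U: "S \<subseteq> closure U"
    and separates: "\<And>d u. d \<in> D \<Longrightarrow> u \<in> U \<Longrightarrow> \<not> connected_component (- S) d u"
begin

text \<open>The missing point \<open>x\<close> lies in both closures, so it can be added to
  \<open>D\<close> and to \<open>U\<close> without losing connectedness; it then glues the two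
  together off \<open>P\<close>.\<close>

lemma not_separated_if_proper:
  assumes "closed P" "P \<subseteq> S" "x \<in> S" "x \<notin> P" "d \<in> D" "u \<in> U"
  shows "connected_component (- P) d u"
proof -
  have "connected (insert x D)"
    by (rule connected_intermediate_closure[OF connected_D]) (use closure_D \<open>x \<in> S\<close> closure_subset in auto)
  moreover have "connected (insert x U)"
    by (rule connected_intermediate_closure[OF connected_U]) (use closure_U \<open>x \<in> S\<close> closure_subset in auto)
  ultimately have "connected (insert x D \<union> insert x U)"
    by (intro connected_Un) auto
  moreover have "insert x D \<union> insert x U \<subseteq> - P"
    using assms disjoint_D disjoint_U by auto
  ultimately show ?thesis
    using assms unfolding connected_component_def by blast
qed

text \<open>If both pieces were proper, neither would separate \<open>D\<close> from
  \<open>U\<close>; as they meet in a connected set, Janiszewski's theorem shows that their union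
  \<open>S\<close> would not separate them either.\<close>

lemma closed_cover_trivial:
  assumes "closed P" "closed Q" "P \<union> Q = S" "connected (P \<inter> Q)"
  shows "P = S \<or> Q = S"
proof (rule ccontr)
  assume "\<not> ?thesis"
  then obtain x y where xy: "x \<in> S" "x \<notin> P" "y \<in> S" "y \<notin> Q"
    using assms(3) by blast
  obtain d u where du: "d \<in> D" "u \<in> U"
    using nonempty_D nonempty_U by blast
  have "compact P"
    using assms compact_S by (metis closed_subset closedin_compact sup_ge1)
  then have "connected_component (- (P \<union> Q)) d u"
  proof (rule Janiszewski)
    show "connected_component (- P) d u"
      by (rule not_separated_if_proper[of P x]) (use xy assms du in auto)
    show "connected_component (- Q) d u"
      by (rule not_separated_if_proper[of Q y]) (use xy assms du in auto)
  qed (use assms in auto)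
  then show False
    using separates[OF du] assms by simp
qed

lemma connected_S: "connected S"
proof -
  have False if "closed P" "closed Q" "P \<noteq> {}" "Q \<noteq> {}" "P \<union> Q = S" "P \<inter> Q = {}" for P Q
    using closed_cover_trivial[of P Q] that by auto
  then show ?thesis
    unfolding connected_closed_set[OF compact_imp_closed[OF compact_S]] by blast
qed

text \<open>Putting \<open>m\<close> back into both halves of a separation gives closed sets that
  cover \<open>S\<close> and meet in at most one point. Writing \<open>S \<inter> {m}\<close> treats
  the case \<open>m \<notin> S\<close> as well.\<close>

lemma connected_S_delete: "connected (S - {m})"
proof (rule ccontr)
  assume "\<not> ?thesis"
  then obtain P Q where PQ: "closedin (top_of_set (S - {m})) P" "closedin (top_of_set (S - {m})) Q"
      "P \<union> Q = S - {m}" "P \<inter> Q = {}" "P \<noteq> {}" "Q \<noteq> {}"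
    unfolding connected_closedin_eq by blast
  have cl: "closed (R \<union> (S \<inter> {m}))" if R: "closedin (top_of_set (S - {m})) R" for R
  proof -
    obtain T where "closed T" "R = (S - {m}) \<inter> T"
      using R by (auto simp only: closedin_closed)
    then have "R \<union> (S \<inter> {m}) = (S \<inter> T) \<union> (S \<inter> {m})" by auto
    then show ?thesis
      using compact_S \<open>closed T\<close> by (simp add: closed_Int closed_Un compact_imp_closed)
  qed
  have "P \<union> (S \<inter> {m}) = S \<or> Q \<union> (S \<inter> {m}) = S"
  proof (rule closed_cover_trivial)
    have "(P \<union> (S \<inter> {m})) \<inter> (Q \<union> (S \<inter> {m})) = S \<inter> {m}"
      using PQ(4) by blast
    moreover have "connected (S \<inter> {m})"
      by (cases "m \<in> S") auto
    ultimately show "connected ((P \<union> (S \<inter> {m})) \<inter> (Q \<union> (S \<inter> {m})))"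
      by (simp only:)
  qed (use PQ cl in auto)
  then show False using PQ by blast
qed

text \<open>A set with at most one point does not disconnect the plane, so it cannot separate
  \<open>D\<close> from \<open>U\<close>.\<close>

lemma two_points: "\<exists>p\<in>S. \<exists>q\<in>S. p \<noteq> q"
proof (rule ccontr)
  assume "\<not> ?thesis"
  then obtain m where "S \<subseteq> {m}" by blast
  moreover have "connected (- {m})"
    by (rule connected_punctured_universe) simp
  moreover obtain d u where du: "d \<in> D" "u \<in> U"
    using nonempty_D nonempty_U by blast
  moreover have "connected (- S)"
    using calculation(1,2) by (metis Compl_empty_eq connected_UNIV subset_singletonD)
  ultimately show False
    using separates[OF du] disjoint_D disjoint_U unfolding connected_component_def
    by (metis ComplI disjoint_iff order_refl)
qed

end

section \<open>Extracting a loop from an arc and a detour\<close>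

lemma locally_path_connected_imp_path_connected:
  assumes "locally path_connected S" "connected S"
  shows "path_connected S"
  using assms by (simp add: path_connected_component connected_iff_connected_component path_component_eq_connected_component)

text \<open>The times \<open>s\<close> and \<open>t\<close> are the last visit to \<open>B\<close>
  before \<open>m\<close> and the first one after it; they exist because the set of visiting times
  is compact.\<close>

lemma path_excursion_from_closed:
  fixes g :: "real \<Rightarrow> 'a::t2_space"
  assumes "path g" "closed B" "g 0 \<in> B" "g 1 \<in> B" "0 < m" "m < 1" "g m \<notin> B"
  obtains s t where "0 \<le> s" "s < m" "m < t" "t \<le> 1" "g s \<in> B" "g t \<in> B" "\<And>x. s < x \<Longrightarrow> x < t \<Longrightarrow> g x \<notin> B"
proof -
  define Z where "Z = {0..1} \<inter> g -` B"
  have "closed Z"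
    unfolding Z_def using assms(1,2) by (auto simp: path_def intro: continuous_closed_preimage)
  have 1: "compact (Z \<inter> {..m})" "compact (Z \<inter> {m..})"
    using \<open>closed Z\<close> by (auto intro!: closed_Int simp: compact_eq_bounded_closed Z_def bounded_Int)
  have "0 \<in> Z \<inter> {..m}" "1 \<in> Z \<inter> {m..}" using assms by (auto simp: Z_def)
  then obtain s t where s: "s \<in> Z \<inter> {..m}" "\<forall>x\<in>Z \<inter> {..m}. x \<le> s" 
      and t: "t \<in> Z \<inter> {m..}" "\<forall>x\<in>Z \<inter> {m..}. t \<le> x"
    using compact_attains_sup[OF 1(1)] compact_attains_inf[OF 1(2)] by blast
  have "m \<notin> Z" using assms by (auto simp: Z_def)
  show thesis
  proof (rule that[of s t])
    show "g x \<notin> B" if "s < x" "x < t" for x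
    proof
      assume "g x \<in> B"
      then have "x \<in> Z" using that s t by (auto simp: Z_def)
      then show False using s(2) t(2) that by (cases "x \<le> m") force+
    qed
  qed (use s(1) t(1) \<open>m \<notin> Z\<close> in \<open>auto simp: Z_def less_le\<close>)
qed

text \<open>The stretch of \<open>g\<close> around its midpoint that stays off the image of
  \<open>h\<close> is an arc touching that image only at its two ends; an arc inside the image of
  \<open>h\<close> joins these ends and closes the loop.\<close>

lemma arc_and_detour_contain_loop:
  fixes g h :: "real \<Rightarrow> complex"
  assumes "arc g" "path h" "pathstart h = pathstart g" "pathfinish h = pathfinish g" "g (1/2) \<notin> path_image h"
  obtains g1 g2 where "arc g1" "arc g2" "pathfinish g1 = pathstart g2" "pathfinish g2 = pathstart g1"
    "path_image g1 \<inter> path_image g2 = {pathstart g1, pathstart g2}"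
    "path_image g1 \<subseteq> path_image g" "path_image g2 \<subseteq> path_image h"
proof -
  have ends: "g 0 \<in> path_image h" "g 1 \<in> path_image h"
    using assms(3,4) by (metis pathstart_def pathfinish_def pathstart_in_path_image pathfinish_in_path_image)+
  have "path g" "inj_on g {0..1}"
    using assms(1) by (auto simp: arc_def)
  obtain s t where st: "0 \<le> s" "s < 1/2" "1/2 < t" "t \<le> 1" "g s \<in> path_image h" "g t \<in> path_image h"
      "\<And>x. s < x \<Longrightarrow> x < t \<Longrightarrow> g x \<notin> path_image h"
    by (rule path_excursion_from_closed[of g "path_image h" "1/2"])
       (use \<open>path g\<close> assms(2,5) ends closed_path_image in auto)
  have "path_connected (path_image h)"
    using assms(2) by (rule path_connected_path_image)
  moreover have "g s \<noteq> g t"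
    using \<open>inj_on g {0..1}\<close> st(1-4) by (subst inj_on_eq_iff[OF \<open>inj_on g {0..1}\<close>]) auto
  ultimately obtain g2 where g2: "arc g2" "path_image g2 \<subseteq> path_image h" "pathstart g2 = g t" "pathfinish g2 = g s"
    using st(5,6) by (metis path_connected_arcwise)
  show thesis
  proof (rule that[of "subpath s t g" g2])
    show "arc (subpath s t g)"
      using assms(1) st by (intro arc_subpath_arc) auto
    have img: "path_image (subpath s t g) = g ` {s..t}"
      using st by (simp add: path_image_subpath)
    show "path_image (subpath s t g) \<subseteq> path_image g"
      unfolding img using st by (auto simp: path_image_def)
    have "g s \<in> path_image g2" "g t \<in> path_image g2"
      using g2 by (metis pathstart_in_path_image pathfinish_in_path_image)+
    moreover have "x = g s \<or> x = g t" if "x \<in> g ` {s..t}" "x \<in> path_image h" for x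
      using that st(7) by (force simp: less_le)
    ultimately show "path_image (subpath s t g) \<inter> path_image g2 = {pathstart (subpath s t g), pathstart g2}"
      unfolding img using g2 st by auto
  qed (use g2 in auto)
qed

context common_boundary
begin

text \<open>Two points of \<open>S\<close> are joined by an arc in \<open>S\<close>. Its midpoint is
  no cut point, and local path connectedness passes to the relatively open rest of \<open>S\<close>,
  so a path in \<open>S\<close> bypasses the midpoint.\<close>

lemma loop_in_S:
  assumes "locally path_connected S"
  obtains g1 g2 where "arc g1" "arc g2" "pathfinish g1 = pathstart g2" "pathfinish g2 = pathstart g1"
    "path_image g1 \<inter> path_image g2 = {pathstart g1, pathstart g2}"
    "path_image g1 \<subseteq> S" "path_image g2 \<subseteq> S"
proof -
  obtain p q where pq: "p \<in> S" "q \<in> S" "p \<noteq> q"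
    using two_points by blast
  have "path_connected S"
    using assms connected_S by (simp add: locally_path_connected_imp_path_connected)
  then obtain g where g: "arc g" "path_image g \<subseteq> S" "pathstart g = p" "pathfinish g = q"
    using pq by (metis path_connected_arcwise)
  have inj: "inj_on g {0..1}" using g(1) by (auto simp: arc_def)
  let ?m = "g (1/2)"
  have ne: "p \<noteq> ?m" "q \<noteq> ?m"
    using g(3,4) inj_onD[OF inj, of 0 "1/2"] inj_onD[OF inj, of 1 "1/2"]
    by (auto simp: pathstart_def pathfinish_def)
  have "locally path_connected (S - {?m})"
    by (rule locally_open_subset[OF assms]) (simp add: openin_delete)
  then have "path_connected (S - {?m})"
    using connected_S_delete by (simp add: locally_path_connected_imp_path_connected)
  then obtain h where h: "path h" "path_image h \<subseteq> S - {?m}" "pathstart h = p" "pathfinish h = q"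
    using pq ne unfolding path_connected_def by blast
  show thesis
  proof (rule arc_and_detour_contain_loop[of g h])
    show "g (1/2) \<notin> path_image h" using h by auto
  next
    fix g1 g2 assume "path_image g1 \<subseteq> path_image g" "path_image g2 \<subseteq> path_image h" 
      and *: "arc g1" "arc g2" "pathfinish g1 = pathstart g2" "pathfinish g2 = pathstart g1"
        "path_image g1 \<inter> path_image g2 = {pathstart g1, pathstart g2}"
    then have "path_image g1 \<subseteq> S" "path_image g2 \<subseteq> S" using g h by auto
    then show thesis by (rule that[OF *])
  qed (use g h in auto)
qed

text \<open>In the theta curve formed by \<open>g1\<close>, \<open>g2\<close> and \<open>h\<close>, a cycle through \<open>h\<close> does not separate \<open>D\<close> from \<open>W\<close>, because
  both accumulate on the remaining arc; the two such cycles meet in the connected set \<open>h\<close>, so Janiszewski applies.\<close>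
lemma loop_not_separating:
  assumes "arc g1" "arc g2" "pathfinish g1 = pathstart g2" "pathfinish g2 = pathstart g1"
    and int: "path_image g1 \<inter> path_image g2 = {pathstart g1, pathstart g2}"
    and sub: "path_image g1 \<subseteq> S" "path_image g2 \<subseteq> S"
    and h: "path h" "pathstart h = pathstart g1" "pathfinish h = pathfinish g1"
      "path_image h \<subseteq> U \<union> {pathstart g1, pathfinish g1}"
    and W: "connected W" "W \<noteq> {}" "W \<inter> U = {}" "path_image g1 \<union> path_image g2 \<subseteq> closure W"
      "W \<inter> (path_image g1 \<union> path_image g2) = {}"
    and d: "d \<in> D" and w: "w \<in> W"
  shows "connected_component (- (path_image g1 \<union> path_image g2)) d w"
proof -
  let ?C1 = "path_image g1" and ?C2 = "path_image g2" and ?H = "path_image h"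
  have DU: "D \<inter> U = {}"
    using separates disjoint_D connected_component_refl by fastforce
  have Hin: "?C1 \<inter> ?C2 \<subseteq> ?H"
    using int h assms(3) pathstart_in_path_image[of h] pathfinish_in_path_image[of h] by auto
  have nontriv: "?C1 - {pathstart g1, pathstart g2} \<noteq> {}" "?C2 - {pathstart g1, pathstart g2} \<noteq> {}"
    using nonempty_simple_path_endless[OF arc_imp_simple_path[OF assms(1)]]
      nonempty_simple_path_endless[OF arc_imp_simple_path[OF assms(2)]]
    by (simp_all add: assms(3,4) insert_commute)
  \<comment> \<open>\<open>X\<close> and \<open>Y\<close> are the two arcs in either order;
    \<open>?Y\<close> is the open arc across which \<open>D\<close> and \<open>W\<close> get
    joined.\<close>
  have 1: "connected_component (- (X \<union> ?H)) d w"
    if XY: "X \<union> Y = ?C1 \<union> ?C2" "Y - {pathstart g1, pathstart g2} \<noteq> {}" "X \<inter> Y = {pathstart g1, pathstart g2}" for X Y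
  proof -
    let ?Y = "Y - {pathstart g1, pathstart g2}"
    have YS: "?Y \<subseteq> S" "?Y \<subseteq> closure W" using XY sub W by auto
    have "connected (D \<union> ?Y)"
      by (rule connected_intermediate_closure[OF connected_D]) (use YS closure_D closure_subset[of D] in auto)
    moreover have "connected (W \<union> ?Y)"
      by (rule connected_intermediate_closure[OF W(1)]) (use YS closure_subset[of W] in auto)
    ultimately have "connected ((D \<union> ?Y) \<union> (W \<union> ?Y))"
      by (rule connected_Un) (use XY in auto)
    moreover have "(D \<union> ?Y) \<union> (W \<union> ?Y) \<subseteq> - (X \<union> ?H)"
    proof -
      have X: "X \<subseteq> ?C1 \<union> ?C2" "X \<subseteq> S" using XY(1) sub by auto
      have H: "?H \<subseteq> U \<union> X" using h(4) assms(3) XY(3) by auto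
      have "D \<inter> (X \<union> ?H) = {}" using H X(2) DU disjoint_D by fast
      moreover have "W \<inter> (X \<union> ?H) = {}" using H X(1) W(3,5) by fast
      moreover have "?Y \<inter> (X \<union> ?H) = {}" using H XY(3) YS(1) disjoint_U by fast
      ultimately show ?thesis by fast
    qed
    ultimately show ?thesis
      using d w unfolding connected_component_def by blast
  qed
  have "connected_component (- ((?C1 \<union> ?H) \<union> (?C2 \<union> ?H))) d w"
  proof (rule Janiszewski)
    show "compact (?C1 \<union> ?H)" "closed (?C2 \<union> ?H)"
      using assms(1,2) h(1) by (auto simp: compact_Un compact_arc_image compact_path_image closed_arc_image closed_path_image)
    have "(?C1 \<union> ?H) \<inter> (?C2 \<union> ?H) = ?H" using Hin by auto
    then show "connected ((?C1 \<union> ?H) \<inter> (?C2 \<union> ?H))"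
      using h(1) by (simp add: connected_path_image)
    show "connected_component (- (?C1 \<union> ?H)) d w"
      by (rule 1[of _ ?C2]) (use int nontriv in auto)
    show "connected_component (- (?C2 \<union> ?H)) d w"
      by (rule 1[of _ ?C1]) (use int nontriv in auto)
  qed
  then show ?thesis
    by (rule connected_component_of_subset) auto
qed

text \<open>If \<open>D\<close> and \<open>U\<close> were on the same side of the loop, the other
  side would be joined to \<open>D\<close> off the loop by \<open>loop_not_separating\<close>, which
  is impossible. So they lie on different sides, and a point of \<open>S\<close>, being in both
  closures, must be on the loop.\<close>

theorem S_is_Jordan_curve:
  assumes lpc: "locally path_connected S"
    and acc: "\<And>p q. p \<in> S \<Longrightarrow> q \<in> S \<Longrightarrow> 
      \<exists>h. path h \<and> pathstart h = p \<and> pathfinish h = q \<and> path_image h \<subseteq> U \<union> {p, q}"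
  obtains c where "simple_path c" "pathfinish c = pathstart c" "path_image c = S"
proof -
  obtain g1 g2 where g: "arc g1" "arc g2" "pathfinish g1 = pathstart g2" "pathfinish g2 = pathstart g1"
    "path_image g1 \<inter> path_image g2 = {pathstart g1, pathstart g2}"
    "path_image g1 \<subseteq> S" "path_image g2 \<subseteq> S"
    using loop_in_S[OF lpc] by blast
  define c where "c = g1 +++ g2"
  have c: "simple_path c" "pathfinish c = pathstart c" "path_image c = path_image g1 \<union> path_image g2"
    unfolding c_def using g by (auto intro: simple_path_join_loop simp: path_image_join)
  let ?C = "path_image c"
  have CS: "?C \<subseteq> S" using c g by auto
  note J = Jordan_inside_outside[OF c(1,2)]
  obtain h where h: "path h" "pathstart h = pathstart g1" "pathfinish h = pathfinish g1"
      "path_image h \<subseteq> U \<union> {pathstart g1, pathfinish g1}"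
    using acc[of "pathstart g1" "pathfinish g1"] g(6) by (meson pathstart_in_path_image pathfinish_in_path_image subsetD)
  \<comment> \<open>\<open>W\<close> stands for a side of the loop that contains neither
    \<open>D\<close> nor \<open>U\<close>.\<close>
  have key: False if W: "open W" "connected W" "W \<noteq> {}" "W \<inter> U = {}" "W \<inter> D = {}" "frontier W = ?C" for W
  proof -
    obtain d w where dw: "d \<in> D" "w \<in> W" using nonempty_D W by blast
    have disj: "W \<inter> ?C = {}" using W by (metis frontier_disjoint_eq inf_commute)
    have "connected_component (- (path_image g1 \<union> path_image g2)) d w"
      by (rule loop_not_separating[OF g h]) (use W dw disj c(3) in \<open>auto simp: closure_Un_frontier\<close>)
    then obtain T where T: "connected T" "T \<subseteq> - ?C" "d \<in> T" "w \<in> T"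
      unfolding connected_component_def c(3) by blast
    then have "T \<inter> frontier W \<noteq> {}"
      by (intro connected_Int_frontier) (use dw W in auto)
    then show False using T W by auto
  qed
  have split: "X \<subseteq> inside ?C \<or> X \<subseteq> outside ?C" if "connected X" "X \<inter> S = {}" for X
  proof (rule ccontr)
    assume *: "\<not> ?thesis"
    have "X \<subseteq> inside ?C \<union> outside ?C" using that CS J by blast
    then have "X \<inter> inside ?C \<noteq> {}" "X - inside ?C \<noteq> {}" using * by blast+
    then have "X \<inter> frontier (inside ?C) \<noteq> {}"
      by (intro connected_Int_frontier that)
    then show False using J that CS by auto
  qed
  have "\<not> (D \<subseteq> inside ?C \<and> U \<subseteq> inside ?C)"
    using key[of "outside ?C"] J by blast
  moreover have "\<not> (D \<subseteq> outside ?C \<and> U \<subseteq> outside ?C)"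
    using key[of "inside ?C"] J by blast
  ultimately have "(D \<subseteq> inside ?C \<and> U \<subseteq> outside ?C) \<or> (U \<subseteq> inside ?C \<and> D \<subseteq> outside ?C)"
    using split[OF connected_D disjoint_D] split[OF connected_U disjoint_U] by argo
  then have "closure D \<inter> closure U \<subseteq> closure (inside ?C) \<inter> closure (outside ?C)"
    using closure_mono by blast
  also have "\<dots> = (inside ?C \<union> ?C) \<inter> (outside ?C \<union> ?C)"
    using J by (simp add: closure_Un_frontier)
  also have "\<dots> = ?C" using J by blast
  finally have "S \<subseteq> ?C" using closure_D closure_U by blast
  then show thesis using that c CS by blast
qed

end

section \<open>Level sets of the distance function\<close>

text \<open>The infimum is attained, which turns even the strict bound
  \<open>e < infdist z K\<close> into a pointwise condition.\<close>

lemma infdist_less_iff: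
  fixes K :: "'a::heine_borel set"
  assumes "closed K" "K \<noteq> {}"
  shows "infdist z K < e \<longleftrightarrow> (\<exists>a\<in>K. dist z a < e)" "e < infdist z K \<longleftrightarrow> (\<forall>a\<in>K. e < dist z a)"
    "infdist z K \<le> e \<longleftrightarrow> (\<exists>a\<in>K. dist z a \<le> e)" "e \<le> infdist z K \<longleftrightarrow> (\<forall>a\<in>K. e \<le> dist z a)"
proof -
  obtain a where a: "a \<in> K" "infdist z K = dist z a"
    using infdist_attains_inf[OF assms] by blast
  have "infdist z K \<le> dist z b" if "b \<in> K" for b
    using that by (rule infdist_le)
  with a show "infdist z K < e \<longleftrightarrow> (\<exists>a\<in>K. dist z a < e)" "e < infdist z K \<longleftrightarrow> (\<forall>a\<in>K. e < dist z a)"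
    "infdist z K \<le> e \<longleftrightarrow> (\<exists>a\<in>K. dist z a \<le> e)" "e \<le> infdist z K \<longleftrightarrow> (\<forall>a\<in>K. e \<le> dist z a)"
    by force+
qed

lemma dist_less_iff_square:
  assumes "0 < e"
  shows "dist z a < e \<longleftrightarrow> (Re z - Re a)\<^sup>2 + (Im z - Im a)\<^sup>2 < e\<^sup>2"
    "e < dist z a \<longleftrightarrow> e\<^sup>2 < (Re z - Re a)\<^sup>2 + (Im z - Im a)\<^sup>2"
  using assms abs_le_square_iff[of e "cmod (z - a)"] abs_le_square_iff[of "cmod (z - a)" e]
  by (auto simp: dist_norm cmod_power2 not_le[symmetric])

lemma norm_eq_iff_square:
  assumes "0 < e"
  shows "e \<le> cmod a \<longleftrightarrow> e\<^sup>2 \<le> (Re a)\<^sup>2 + (Im a)\<^sup>2" "cmod a = e \<longleftrightarrow> (Re a)\<^sup>2 + (Im a)\<^sup>2 = e\<^sup>2"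
proof -
  show "e \<le> cmod a \<longleftrightarrow> e\<^sup>2 \<le> (Re a)\<^sup>2 + (Im a)\<^sup>2"
    using assms abs_le_square_iff[of e "cmod a"] by (simp add: cmod_power2)
  show "cmod a = e \<longleftrightarrow> (Re a)\<^sup>2 + (Im a)\<^sup>2 = e\<^sup>2"
    unfolding cmod_power2[symmetric] using assms by (auto simp: power2_eq_iff_nonneg)
qed

text \<open>Compactness makes the strict bound uniform. It is applied to parts of \<open>K\<close>
  without points nearest to 0: these stay farther than \<open>e\<close> from everything close to
  0.\<close>

lemma compact_norm_gap:
  fixes K :: "complex set"
  assumes "compact K" "\<And>a. a \<in> K \<Longrightarrow> e < cmod a"
  obtains \<eta> where "\<eta> > 0" "\<And>a. a \<in> K \<Longrightarrow> e + \<eta> \<le> cmod a"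
proof (cases "K = {}")
  case False
  obtain b where b: "b \<in> K" "\<And>a. a \<in> K \<Longrightarrow> cmod b \<le> cmod a"
    using continuous_attains_inf[OF assms(1) False, of cmod] by (auto intro: continuous_intros)
  show thesis by (rule that[of "cmod b - e"]) (use b assms in auto)
qed (use that[of 1] in auto)

text \<open>Moving up from a point at distance at most \<open>e\<close> of \<open>K\<close> decreases the distance; so the level set meets
  each vertical segment once, and being closed it is the graph of a continuous function.\<close>
lemma level_set_is_graph:
  fixes K :: "complex set"
  assumes "compact K" "K \<noteq> {}" "0 < e" "0 < h"
    and above: "\<And>a. a \<in> K \<Longrightarrow> h < Im a"
    and zero: "infdist 0 K = e"
  obtains \<delta> f where "\<delta> > 0" "continuous_on {-\<delta>..\<delta>} f" "f 0 = 0" "\<And>x. \<bar>x\<bar> \<le> \<delta> \<Longrightarrow> \<bar>f x\<bar> < h"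
    "\<And>x y. \<bar>x\<bar> \<le> \<delta> \<Longrightarrow> \<bar>y\<bar> \<le> h \<Longrightarrow> infdist (Complex x y) K < e \<longleftrightarrow> f x < y"
    "\<And>x y. \<bar>x\<bar> \<le> \<delta> \<Longrightarrow> \<bar>y\<bar> \<le> h \<Longrightarrow> e < infdist (Complex x y) K \<longleftrightarrow> y < f x"
proof -
  let ?F = "\<lambda>x y. infdist (Complex x y) K"
  note cl = infdist_less_iff[OF compact_imp_closed[OF assms(1)] assms(2)]
  have up: "?F x y' < e" if le: "?F x y \<le> e" and y: "y < y'" "y' \<le> h" for x y y'
  proof -
    obtain a where a: "a \<in> K" "dist (Complex x y) a \<le> e"
      using le unfolding cl(3) by blast
    have "h < Im a" using above a by blast
    then have "(Im a - y')\<^sup>2 < (Im a - y)\<^sup>2"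
      using y by (intro power_strict_mono) auto
    then have "dist (Complex x y') a < dist (Complex x y) a"
      by (simp add: dist_norm cmod_def power2_commute)
    then show ?thesis using a unfolding cl(1) by (meson less_le_trans)
  qed
  have zero': "e \<le> cmod a" if "a \<in> K" for a
    using zero cl(4)[of e 0] that by auto
  \<comment> \<open>Each \<open>a\<close> has norm at least \<open>e\<close> and positive imaginary
    part, so stepping down from 0 strictly increases the distance to it.\<close>
  have low: "e < ?F 0 (-h)"
    unfolding cl(2) dist_less_iff_square[OF \<open>0 < e\<close>]
  proof
    fix a assume a: "a \<in> K"
    have "(Im a)\<^sup>2 < (Im a + h)\<^sup>2"
      using above[OF a] \<open>0 < h\<close> by (intro power_strict_mono) auto
    moreover have "(- h - Im a)\<^sup>2 = (Im a + h)\<^sup>2"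
      by (simp add: power2_eq_square algebra_simps)
    ultimately show "e\<^sup>2 < (Re (Complex 0 (- h)) - Re a)\<^sup>2 + (Im (Complex 0 (- h)) - Im a)\<^sup>2"
      using zero'[OF a] unfolding norm_eq_iff_square[OF \<open>0 < e\<close>] by simp
  qed
  have high: "?F 0 h < e"
    by (rule up[of 0 0 h]) (use zero \<open>0 < h\<close> in \<open>simp_all flip: zero_complex.code\<close>)
  \<comment> \<open>The distance is 1-Lipschitz; moving sideways by at most half the smaller margin
    preserves the strict inequalities at heights \<open>-h\<close> and \<open>h\<close>.\<close>
  define \<delta> where "\<delta> = min (?F 0 (-h) - e) (e - ?F 0 h) / 2"
  have "\<delta> > 0" using low high by (simp add: \<delta>_def)
  have lip: "\<bar>?F x y - ?F 0 y\<bar> \<le> \<bar>x\<bar>" for x y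
    using infdist_triangle_abs[of "Complex x y" K "Complex 0 y"] by (simp add: dist_norm cmod_def)
  have \<delta>: "2 * \<delta> \<le> ?F 0 (-h) - e" "2 * \<delta> \<le> e - ?F 0 h"
    by (simp_all add: \<delta>_def)
  have low': "e < ?F x (-h)" if "\<bar>x\<bar> \<le> \<delta>" for x
    using lip[of x "-h"] that low \<delta>(1) by linarith
  have high': "?F x h < e" if "\<bar>x\<bar> \<le> \<delta>" for x
    using lip[of x h] that high \<delta>(2) by linarith
  have cont: "continuous_on UNIV (\<lambda>z. ?F (fst z) (snd z))"
    unfolding Complex_eq by (intro continuous_intros)
  have "\<exists>y. -h \<le> y \<and> y \<le> h \<and> ?F x y = e" if "\<bar>x\<bar> \<le> \<delta>" for x
  proof -
    have "continuous_on {-h..h} (?F x)"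
      unfolding Complex_eq by (intro continuous_intros)
    then show ?thesis
      using IVT2'[of "?F x" h e "-h"] low'[OF that] high'[OF that] \<open>0 < h\<close> by auto
  qed
  then obtain f where f: "\<And>x. \<bar>x\<bar> \<le> \<delta> \<Longrightarrow> -h \<le> f x \<and> f x \<le> h \<and> ?F x (f x) = e"
    by meson
  have less: "?F x y < e \<longleftrightarrow> f x < y" and gt: "e < ?F x y \<longleftrightarrow> y < f x" if "\<bar>x\<bar> \<le> \<delta>" "\<bar>y\<bar> \<le> h" for x y
  proof -
    have "-h \<le> f x" "f x \<le> h" "?F x (f x) = e" "y \<le> h" using f[OF that(1)] that(2) by auto
    then show "?F x y < e \<longleftrightarrow> f x < y" "e < ?F x y \<longleftrightarrow> y < f x"
      using up[of x "f x" y] up[of x y "f x"] by (cases rule: linorder_cases[of y "f x"]; force)+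
  qed
  have bound: "\<bar>f x\<bar> < h" if "\<bar>x\<bar> \<le> \<delta>" for x
    using less[of x h] gt[of x "-h"] low'[OF that] high'[OF that] that \<open>0 < h\<close> by auto
  show thesis
  proof (rule that[OF \<open>\<delta> > 0\<close> _ _ bound less gt])
    show "f 0 = 0"
      using less[of 0 0] gt[of 0 0] zero \<open>0 < h\<close> \<open>\<delta> > 0\<close> by (simp flip: zero_complex.code)
    \<comment> \<open>The graph is the level set inside the box, hence closed; a function with
      closed graph and values in a compact interval is continuous.\<close>
    have "(\<lambda>x. (x, f x)) ` {-\<delta>..\<delta>} = ({-\<delta>..\<delta>} \<times> {-h..h}) \<inter> (\<lambda>z. ?F (fst z) (snd z)) -` {e}"
    proof (intro set_eqI iffI)
      fix z assume "z \<in> ({-\<delta>..\<delta>} \<times> {-h..h}) \<inter> (\<lambda>z. ?F (fst z) (snd z)) -` {e}"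
      then obtain x y where z: "z = (x, y)" "x \<in> {-\<delta>..\<delta>}" "\<bar>x\<bar> \<le> \<delta>" "\<bar>y\<bar> \<le> h" "?F x y = e"
        by (cases z) auto
      then have "y = f x" using less[OF z(3,4)] gt[OF z(3,4)] by linarith
      then show "z \<in> (\<lambda>x. (x, f x)) ` {-\<delta>..\<delta>}" using z by blast
    next
      fix z assume "z \<in> (\<lambda>x. (x, f x)) ` {-\<delta>..\<delta>}"
      then obtain x where z: "z = (x, f x)" "x \<in> {-\<delta>..\<delta>}" by blast
      then show "z \<in> ({-\<delta>..\<delta>} \<times> {-h..h}) \<inter> (\<lambda>z. ?F (fst z) (snd z)) -` {e}"
        using f[of x] by (simp add: abs_le_iff)
    qed
    moreover have "closed (({-\<delta>..\<delta>} \<times> {-h..h}) \<inter> (\<lambda>z. ?F (fst z) (snd z)) -` {e})"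
      by (rule continuous_closed_preimage) (auto intro: continuous_on_subset[OF cont] closed_Times)
    ultimately have "closed ((\<lambda>x. (x, f x)) ` {-\<delta>..\<delta>})"
      by simp
    moreover have "f \<in> {-\<delta>..\<delta>} \<rightarrow> {-h..h}" using f by (auto simp: abs_le_iff)
    ultimately show "continuous_on {-\<delta>..\<delta>} f"
      using continuous_from_closed_graph[of "{-h..h}" f "{-\<delta>..\<delta>}"] by simp
  qed auto
qed

section \<open>Regions between graphs and paths along graphs\<close>

text \<open>Affine interpolation between \<open>g\<close> and \<open>f\<close> on each vertical line
  maps an open rectangle onto the region.\<close>

lemma connected_between_graphs:
  fixes f g :: "real \<Rightarrow> real"
  assumes "continuous_on {a<..<b} f" "continuous_on {a<..<b} g"
    and "\<And>x. a < x \<Longrightarrow> x < b \<Longrightarrow> g x < f x"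
  shows "connected {z. a < Re z \<and> Re z < b \<and> g (Re z) < Im z \<and> Im z < f (Re z)}" (is "connected ?R")
proof -
  let ?\<phi> = "\<lambda>z. Complex (fst z) (g (fst z) + snd z * (f (fst z) - g (fst z)))"
  have "connected (?\<phi> ` ({a<..<b} \<times> {0<..<1}))"
    unfolding Complex_eq
    by (intro connected_continuous_image connected_Times continuous_intros
        continuous_on_compose2[OF assms(1)] continuous_on_compose2[OF assms(2)]) auto
  also have "?\<phi> ` ({a<..<b} \<times> {0<..<1}) = ?R"
  proof (intro set_eqI iffI)
    fix z assume "z \<in> ?\<phi> ` ({a<..<b} \<times> {0<..<1})"
    then obtain x t where z: "z = Complex x (g x + t * (f x - g x))" "a < x" "x < b" "0 < t" "t < 1"
      unfolding image_iff Bex_def mem_Times_iff by auto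
    have "0 < t * (f x - g x)" "t * (f x - g x) < 1 * (f x - g x)"
      using assms(3)[OF z(2,3)] z(4,5) by (auto intro: mult_strict_right_mono)
    then show "z \<in> ?R" using z by simp
  next
    fix z assume z: "z \<in> ?R"
    then have "g (Re z) < f (Re z)" using assms(3) by auto
    then have "?\<phi> (Re z, (Im z - g (Re z)) / (f (Re z) - g (Re z))) = z"
      by (simp add: complex_eq_iff)
    moreover have "(Re z, (Im z - g (Re z)) / (f (Re z) - g (Re z))) \<in> {a<..<b} \<times> {0<..<1}"
      using z by (auto simp: divide_simps)
    ultimately show "z \<in> ?\<phi> ` ({a<..<b} \<times> {0<..<1})" by (rule image_eqI[OF sym])
  qed
  finally show ?thesis .
qed

lemma vertical_ends_in_closure:
  assumes "g < f" "\<And>y. g < y \<Longrightarrow> y < f \<Longrightarrow> Complex x y \<in> D"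
  shows "Complex x f \<in> closure D" "Complex x g \<in> closure D"
proof -
  have "Complex x ` closure {g<..<f} \<subseteq> closure D"
  proof (rule image_closure_subset)
    show "continuous_on (closure {g<..<f}) (Complex x)"
      unfolding Complex_eq by (intro continuous_intros)
    show "Complex x ` {g<..<f} \<subseteq> closure D"
      using assms(2) closure_subset[of D] by auto
  qed auto
  then show "Complex x f \<in> closure D" "Complex x g \<in> closure D"
    using assms(1) by auto
qed

text \<open>Scaling the parameter by \<open>x\<close> and using \<open>closed_segment 0 x\<close>
  serves both signs of \<open>x\<close>.\<close>

lemma path_along_graph:
  fixes f :: "real \<Rightarrow> real"
  assumes "continuous_on (closed_segment 0 x) f" "f 0 = 0"
    and "\<And>t. t \<in> closed_segment 0 x \<Longrightarrow> Complex t (f t) \<in> T"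
  shows "\<exists>g. path g \<and> path_image g \<subseteq> T \<and> pathstart g = 0 \<and> pathfinish g = Complex x (f x)"
proof (intro exI conjI)
  let ?g = "\<lambda>t. Complex (t * x) (f (t * x))"
  have seg: "t * x \<in> closed_segment 0 x" if "t \<in> {0..1}" for t
    using that by (auto simp: closed_segment_def intro!: exI[of _ t])
  show "path ?g"
    unfolding path_def Complex_eq
    by (intro continuous_intros continuous_on_compose2[OF assms(1)]) (use seg in auto)
  show "path_image ?g \<subseteq> T"
    using assms(3) seg by (auto simp: path_image_def)
  show "pathstart ?g = 0" "pathfinish ?g = Complex x (f x)"
    using assms(2) by (auto simp: pathstart_def pathfinish_def complex_eq_iff)
qed

section \<open>Local structure of the frontier\<close>

text \<open>Holding at every point of \<open>S\<close>, this amounts to local path connectedness.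
  Being stated at a single point, it can be checked after an isometry has moved that point to
  0.\<close>

definition path_connected_im_kleinen_at :: "'a::metric_space set \<Rightarrow> 'a \<Rightarrow> bool" where
  "path_connected_im_kleinen_at S p \<longleftrightarrow> (\<forall>r>0. \<exists>s>0. \<forall>q\<in>S \<inter> ball p s.
     \<exists>g. path g \<and> path_image g \<subseteq> S \<inter> ball p r \<and> pathstart g = p \<and> pathfinish g = q)"

text \<open>\<open>K\<close> will be the closure of \<open>A\<close>: it has the same distance
  function and, being compact, attains it.\<close>

locale distance_component =
  fixes K :: "complex set" and e :: real and D :: "complex set"
  assumes compact_K: "compact K" and nonempty_K: "K \<noteq> {}" and e_pos: "0 < e"
    and component: "D \<in> components {z. e < infdist z K}"
begin

lemmas infdist_iff = infdist_less_iff[OF compact_imp_closed[OF compact_K] nonempty_K]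

lemma connected_D: "connected D"
  using component by (rule in_components_connected)

lemma D_far: "z \<in> D \<Longrightarrow> e < infdist z K"
  using in_components_subset[OF component] by auto

lemma D_maximal:
  assumes "connected T" "\<And>z. z \<in> T \<Longrightarrow> e < infdist z K" "z \<in> T" "z \<in> D"
  shows "T \<subseteq> D"
  by (rule components_maximal[OF component]) (use assms in auto)

lemma open_far: "open {z. e < infdist z K}"
  by (intro open_Collect_less continuous_intros)

lemma open_D: "open D"
  using open_components[OF open_far component] .

text \<open>Limits of points of \<open>D\<close> have distance at least \<open>e\<close>. A larger
  distance is excluded because the frontier of a component lies in the frontier of the whole open
  set of far points.\<close>

lemma frontier_infdist:
  assumes "z \<in> frontier D"
  shows "infdist z K = e"
proof -
  have "closure D \<subseteq> {z. e \<le> infdist z K}"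
  proof (rule closure_minimal)
    show "closed {z. e \<le> infdist z K}"
      by (intro closed_Collect_le continuous_intros)
  qed (use D_far less_imp_le in blast)
  moreover have "z \<in> frontier {z. e < infdist z K}"
    using frontier_of_components_subset[OF component] assms by auto
  then have "\<not> e < infdist z K"
    using open_far by (simp add: frontier_def interior_open)
  ultimately show ?thesis
    using assms by (force simp: frontier_def)
qed

lemma frontierI: "z \<in> closure D \<Longrightarrow> infdist z K \<le> e \<Longrightarrow> z \<in> frontier D"
  using D_far[of z] open_D by (auto simp: frontier_def interior_open)

text \<open>The half plane case in normal position. Only the part of \<open>K\<close> well above the
  real axis matters in a small box around 0, so there the far points are those below a graph. They
  form a connected region that \<open>D\<close> enters, hence \<open>D\<close> contains it, and near
  0 the frontier is the graph.\<close>

lemma im_kleinen_if_graph: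
  assumes zero: "0 \<in> frontier D"
    and near: "\<And>a. a \<in> K \<Longrightarrow> cmod a = e \<Longrightarrow> 0 < Im a"
  shows "path_connected_im_kleinen_at (frontier D) 0"
  unfolding path_connected_im_kleinen_at_def
proof (intro allI impI)
  fix r :: real assume "0 < r"
  have inf0: "infdist 0 K = e" using frontier_infdist[OF zero] .
  have norm_ge: "e \<le> cmod a" if "a \<in> K" for a
    using inf0 infdist_iff(4)[of e 0] that by auto
  define M where "M = K \<inter> sphere 0 e"
  have "compact M" unfolding M_def using compact_K by (simp add: compact_Int_closed)
  obtain a0 where a0: "a0 \<in> K" "cmod a0 = e"
    using infdist_iff(3)[of 0 e] inf0 norm_ge by force
  then have "M \<noteq> {}" by (auto simp: M_def)
  then obtain b where b: "b \<in> M" "\<And>a. a \<in> M \<Longrightarrow> Im b \<le> Im a"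
    using continuous_attains_inf[OF \<open>compact M\<close> _ continuous_on_Im[OF continuous_on_id]] by blast
  define m where "m = Im b"
  have m: "0 < m" "\<And>a. a \<in> K \<Longrightarrow> cmod a = e \<Longrightarrow> m \<le> Im a"
    using b near by (auto simp: m_def M_def)
  \<comment> \<open>Points of \<open>K\<close> nearest to 0 have height at least \<open>m\<close>,
    so the cut at \<open>m / 2\<close> leaves none of them in \<open>K2\<close>.\<close>
  define K1 where "K1 = K \<inter> {a. m / 2 \<le> Im a}"
  define K2 where "K2 = K \<inter> {a. Im a \<le> m / 2}"
  have cK: "compact K1" "compact K2"
    unfolding K1_def K2_def
    by (intro compact_Int_closed[OF compact_K] closed_Collect_le continuous_intros)+
  have K12: "K = K1 \<union> K2" by (auto simp: K1_def K2_def)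
  have "a0 \<in> K1" using a0 m by (fastforce simp: K1_def)
  then have "K1 \<noteq> {}" by blast
  note inf1 = infdist_less_iff[OF compact_imp_closed[OF cK(1)] \<open>K1 \<noteq> {}\<close>]
  have "e < cmod a" if "a \<in> K2" for a
    using that norm_ge[of a] m(1) m(2)[of a] by (force simp: K2_def)
  then obtain \<eta> where \<eta>: "\<eta> > 0" "\<And>a. a \<in> K2 \<Longrightarrow> e + \<eta> \<le> cmod a"
    using compact_norm_gap[OF cK(2)] by blast
  \<comment> \<open>\<open>m / 4\<close> keeps \<open>K1\<close> above the box; the quarters of
    \<open>\<eta>\<close> and \<open>r\<close>, here and in \<open>\<delta>\<close>, bound the norms
    in the box by \<open>\<eta> / 2\<close> and \<open>r / 2\<close>.\<close>
  define h where "h = min (m / 4) (min (\<eta> / 4) (r / 4))"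
  have h: "0 < h" "h \<le> m / 4" "h \<le> \<eta> / 4" "h \<le> r / 4"
    using m \<eta> \<open>0 < r\<close> by (auto simp: h_def)
  have zero1: "infdist 0 K1 = e"
    using inf1(3)[of 0 e] inf1(4)[of e 0] \<open>a0 \<in> K1\<close> a0 norm_ge by (intro antisym) (auto simp: K1_def)
  have above: "h < Im a" if "a \<in> K1" for a
    using that h m(1) by (auto simp: K1_def)
  obtain \<delta>1 f where f: "\<delta>1 > 0" "continuous_on {-\<delta>1..\<delta>1} f" "f 0 = 0" "\<And>x. \<bar>x\<bar> \<le> \<delta>1 \<Longrightarrow> \<bar>f x\<bar> < h"
    "\<And>x y. \<bar>x\<bar> \<le> \<delta>1 \<Longrightarrow> \<bar>y\<bar> \<le> h \<Longrightarrow> infdist (Complex x y) K1 < e \<longleftrightarrow> f x < y"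
    "\<And>x y. \<bar>x\<bar> \<le> \<delta>1 \<Longrightarrow> \<bar>y\<bar> \<le> h \<Longrightarrow> e < infdist (Complex x y) K1 \<longleftrightarrow> y < f x"
    by (rule level_set_is_graph[OF cK(1) \<open>K1 \<noteq> {}\<close> e_pos h(1) above zero1]) blast+
  define \<delta> where "\<delta> = min \<delta>1 (min (\<eta> / 4) (r / 4))"
  have \<delta>: "0 < \<delta>" "\<delta> \<le> \<delta>1" "\<delta> \<le> \<eta> / 4" "\<delta> \<le> r / 4"
    using f(1) \<eta> \<open>0 < r\<close> by (auto simp: \<delta>_def)
  have small: "cmod (Complex x y) \<le> \<bar>x\<bar> + \<bar>y\<bar>" for x y
    using cmod_le[of "Complex x y"] by simp
  have far2: "e < dist (Complex x y) a" if "\<bar>x\<bar> \<le> \<delta>" "\<bar>y\<bar> \<le> h" "a \<in> K2" for x y a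
  proof -
    have "cmod a \<le> cmod (Complex x y) + dist (Complex x y) a"
      by (metis dist_norm norm_minus_commute norm_triangle_sub)
    then show ?thesis
      using small[of x y] \<eta>(2)[OF that(3)] \<eta>(1) that(1,2) \<delta>(3) h(3) by linarith
  qed
  have less: "infdist (Complex x y) K < e \<longleftrightarrow> f x < y" and gt: "e < infdist (Complex x y) K \<longleftrightarrow> y < f x"
    if "\<bar>x\<bar> \<le> \<delta>" "\<bar>y\<bar> \<le> h" for x y
  proof -
    have x: "\<bar>x\<bar> \<le> \<delta>1" using that \<delta> by auto
    show "infdist (Complex x y) K < e \<longleftrightarrow> f x < y" 
      unfolding f(5)[OF x that(2), symmetric] infdist_iff(1) inf1(1) using K12 far2[OF that] by force
    show "e < infdist (Complex x y) K \<longleftrightarrow> y < f x"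
      unfolding f(6)[OF x that(2), symmetric] infdist_iff(2) inf1(2) using K12 far2[OF that] by force
  qed
  have fh: "- h < f x \<and> f x < h" if "- \<delta> \<le> x" "x \<le> \<delta>" for x
    using f(4)[of x] that \<delta> by (auto simp: abs_less_iff abs_le_iff)
  define R where "R = {z. -\<delta> < Re z \<and> Re z < \<delta> \<and> -h < Im z \<and> Im z < f (Re z)}"
  have "connected R"
    unfolding R_def
  proof (rule connected_between_graphs[where g = "\<lambda>_. -h"])
    show "continuous_on {-\<delta><..<\<delta>} f"
      by (rule continuous_on_subset[OF f(2)]) (use \<delta> in auto)
    show "- h < f x" if "- \<delta> < x" "x < \<delta>" for x
      using fh[of x] that by auto
  qed auto
  define s where "s = min \<delta> h"
  have "0 < s" using \<delta> h by (simp add: s_def)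
  have box: "\<bar>Re z\<bar> < \<delta> \<and> \<bar>Im z\<bar> < h" if "z \<in> ball 0 s" for z
    using that abs_Re_le_cmod[of z] abs_Im_le_cmod[of z] by (auto simp: s_def)
  have "0 \<in> closure D" using zero by (simp add: frontier_def)
  then obtain z where z: "z \<in> D" "z \<in> ball 0 s"
    using \<open>0 < s\<close> unfolding closure_approachable by (auto simp: dist_commute)
  have "R \<subseteq> D"
  proof (rule D_maximal[OF \<open>connected R\<close> _ _ \<open>z \<in> D\<close>])
    show "z \<in> R" 
      using box[OF z(2)] D_far[OF z(1)] gt[of "Re z" "Im z"] by (auto simp: R_def)
    show "e < infdist w K" if "w \<in> R" for w
    proof -
      have "\<bar>Re w\<bar> \<le> \<delta>" "\<bar>Im w\<bar> \<le> h" "Im w < f (Re w)"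
        using that fh[of "Re w"] by (auto simp: R_def)
      then show ?thesis using gt[of "Re w" "Im w"] by simp
    qed
  qed
  have graph: "Complex x (f x) \<in> frontier D \<inter> ball 0 r" if "\<bar>x\<bar> < \<delta>" for x
  proof
    have fx: "- h < f x" "f x < h" "\<bar>f x\<bar> \<le> h" using fh[of x] that by (auto simp: abs_le_iff abs_less_iff)
    have "Complex x (f x) \<in> closure D"
      by (rule vertical_ends_in_closure(1)[of "-h"]) (use fx that \<open>R \<subseteq> D\<close> in \<open>auto simp: R_def\<close>)
    then show "Complex x (f x) \<in> frontier D"
      by (rule frontierI) (use gt[of x "f x"] fx that in auto)
    show "Complex x (f x) \<in> ball 0 r"
      using small[of x "f x"] fx that \<delta>(4) h(4) \<open>0 < r\<close> by simp
  qed
  show "\<exists>s>0. \<forall>q\<in>frontier D \<inter> ball 0 s. \<exists>g. path g \<and> path_image g \<subseteq> frontier D \<inter> ball 0 r \<and> pathstart g = 0 \<and> pathfinish g = q"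
  proof (rule exI[of _ s], intro conjI ballI)
    show "0 < s" by fact
    fix q assume q: "q \<in> frontier D \<inter> ball 0 s"
    then have bq: "\<bar>Re q\<bar> < \<delta>" "\<bar>Im q\<bar> < h" using box by auto
    then have "Im q = f (Re q)"
      using less[of "Re q" "Im q"] gt[of "Re q" "Im q"] frontier_infdist[of q] q by auto
    then have q_eq: "q = Complex (Re q) (f (Re q))" by (simp add: complex_eq_iff)
    have seg: "\<bar>t\<bar> < \<delta>" if "t \<in> closed_segment 0 (Re q)" for t
      using that bq by (auto simp: closed_segment_eq_real_ivl split: if_splits)
    have cont: "continuous_on (closed_segment 0 (Re q)) f"
      by (rule continuous_on_subset[OF f(2)]) (use seg \<delta>(2) in force)
    show "\<exists>g. path g \<and> path_image g \<subseteq> frontier D \<inter> ball 0 r \<and> pathstart g = 0 \<and> pathfinish g = q"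
      using path_along_graph[OF cont f(3) graph[OF seg]] q_eq by metis
  qed
qed

end

section \<open>The cusp between two antipodal nearest points\<close>

text \<open>The two discs of radius \<open>e\<close> touch the real axis at 0 from above and below,
  so points near 0 outside both hug the axis. Expanding the squares cancels \<open>e\<^sup>2\<close>
  and leaves the bound.\<close>

lemma antipodal_far_imp_flat:
  assumes "0 < e" "e < dist (Complex x y) (Complex 0 e)" "e < dist (Complex x y) (Complex 0 (-e))"
  shows "2 * (e * \<bar>y\<bar>) < x\<^sup>2 + y\<^sup>2"
  using assms(2,3) unfolding dist_less_iff_square[OF assms(1)]
  by (simp add: power2_eq_square algebra_simps abs_if)

context distance_component
begin

text \<open>Accumulation of \<open>D\<close> from the right forces every nearest point into the
  closed left half plane. Just to the right of 0 the far points are then those between the graph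
  \<open>g\<close> of the lower part of \<open>K\<close> and the graph \<open>f\<close> of the upper
  part. This gap stays open as far as \<open>D\<close> reaches, so \<open>D\<close> fills it, and
  the frontier there consists of the two graphs.\<close>

lemma right_cusp:
  assumes antipodal: "Complex 0 e \<in> K" "Complex 0 (-e) \<in> K"
    and norm_ge: "\<And>a. a \<in> K \<Longrightarrow> e \<le> cmod a"
    and accum: "0 \<in> closure (D \<inter> {z. 0 < Re z})"
    and "0 < r"
  shows "\<exists>s>0. \<forall>q\<in>frontier D \<inter> ball 0 s. 0 < Re q \<longrightarrow>
     (\<exists>g. path g \<and> path_image g \<subseteq> frontier D \<inter> ball 0 r \<and> pathstart g = 0 \<and> pathfinish g = q)"
proof -
  have accumE: "\<exists>z\<in>D. 0 < Re z \<and> cmod z < d" if "0 < d" for d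
    using accum that unfolding closure_approachable by (auto simp: dist_norm)
  have flat: "2 * (e * \<bar>y\<bar>) < x\<^sup>2 + y\<^sup>2" if "\<forall>a\<in>K. e < dist (Complex x y) a" for x y
    using antipodal_far_imp_flat[OF e_pos] that antipodal by blast
  have norm_ge': "e\<^sup>2 \<le> (Re a)\<^sup>2 + (Im a)\<^sup>2" if "a \<in> K" for a
    using norm_ge[OF that] norm_eq_iff_square(1)[OF e_pos] by blast
  have inf0: "infdist 0 K = e"
    using infdist_iff(3)[of 0 e] infdist_iff(4)[of e 0] antipodal(1) norm_ge e_pos
    by (intro antisym) (auto intro!: bexI[of _ "Complex 0 e"] simp: dist_norm cmod_def)
  have zero: "0 \<in> frontier D"
    using closure_mono[of "D \<inter> {z. 0 < Re z}" D] accum inf0 by (intro frontierI) auto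
  \<comment> \<open>A point \<open>z\<close> of \<open>D\<close> close to 0 on the right is flat,
    which gives \<open>?n \<le> 2 * ?x\<^sup>2\<close>. Being outside the disc around
    \<open>a\<close> gives \<open>?x * Re a < ?n\<close>. Both together fail once
    \<open>?x < Re a / 2\<close>.\<close>
  have left: "Re a \<le> 0" if a: "a \<in> K" "cmod a = e" for a
  proof (rule ccontr)
    assume neg: "\<not> Re a \<le> 0"
    obtain z where z: "z \<in> D" "0 < Re z" "cmod z < min e (Re a / 2)"
      using accumE[of "min e (Re a / 2)"] neg e_pos by auto
    let ?x = "Re z" and ?y = "Im z" and ?n = "(Re z)\<^sup>2 + (Im z)\<^sup>2"
    have dK: "\<forall>a\<in>K. e < dist z a" using D_far[OF z(1)] infdist_iff(2) by blast
    then have fl: "2 * (e * \<bar>?y\<bar>) < ?n" using flat[of ?x ?y] by simp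
    have nle: "\<bar>?x\<bar> \<le> cmod z" "\<bar>?y\<bar> \<le> cmod z" using abs_Re_le_cmod abs_Im_le_cmod by auto
    have eqa: "(Re a)\<^sup>2 + (Im a)\<^sup>2 = e\<^sup>2" using a(2) norm_eq_iff_square(2)[OF e_pos] by blast
    have "e\<^sup>2 < (?x - Re a)\<^sup>2 + (?y - Im a)\<^sup>2"
      using dK a(1) dist_less_iff_square(2)[OF e_pos] by blast
    then have 1: "2 * (?x * Re a) + 2 * (?y * Im a) < ?n"
      using eqa by (simp add: power2_eq_square algebra_simps)
    have "\<bar>?y * Im a\<bar> \<le> \<bar>?y\<bar> * e"
      unfolding abs_mult using abs_Im_le_cmod[of a] a(2) by (intro mult_left_mono) auto
    then have 2: "?x * Re a < ?n" using 1 fl by (simp add: algebra_simps)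
    have "?y\<^sup>2 \<le> e * \<bar>?y\<bar>"
      using nle(2) z(3) by (metis abs_ge_zero less_imp_le min.strict_boundedE mult_right_mono order_trans power2_abs power2_eq_square)
    then have "?n \<le> 2 * ?x\<^sup>2" using fl by simp
    moreover have "?x * (2 * ?x) < ?x * Re a"
      using nle(1) z(2,3) by (intro mult_strict_left_mono) auto
    ultimately show False using 2 by (simp add: power2_eq_square)
  qed
  define K1 where "K1 = K \<inter> {a. e / 2 \<le> Im a}"
  define K2 where "K2 = K \<inter> {a. Im a \<le> - e / 2}"
  \<comment> \<open>The factor 3/5 lies between 1/2 and sqrt(3)/2. The upper bound keeps nearest
    points out of \<open>K3\<close>, since 9/25 + 1/4 < 1; the lower bound makes the inner product
    \<open>inner\<close> below negative.\<close>
  define K3 where "K3 = K \<inter> {a. Im a \<le> e / 2} \<inter> {a. - e / 2 \<le> Im a} \<inter> {a. - (3 / 5) * e \<le> Re a}"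
  have cK: "compact K1" "compact K2" "compact K3"
    unfolding K1_def K2_def K3_def
    by (intro compact_Int_closed compact_K closed_Collect_le continuous_intros)+
  have K1: "Complex 0 e \<in> K1" and K2: "Complex 0 (-e) \<in> K2"
    using antipodal e_pos by (auto simp: K1_def K2_def)
  have "e < cmod a" if a: "a \<in> K3" for a
  proof (rule ccontr)
    assume "\<not> e < cmod a"
    then have ae: "cmod a = e" "a \<in> K" using norm_ge[of a] a by (auto simp: K3_def)
    then have "(Re a)\<^sup>2 + (Im a)\<^sup>2 = e\<^sup>2" using norm_eq_iff_square(2)[OF e_pos] by blast
    moreover have "(Im a)\<^sup>2 \<le> (e / 2)\<^sup>2"
      using a by (intro abs_le_square_iff[THEN iffD1]) (auto simp: K3_def)
    moreover have "(Re a)\<^sup>2 \<le> (3 / 5 * e)\<^sup>2"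
      using a left[OF ae(2,1)] by (intro abs_le_square_iff[THEN iffD1]) (auto simp: K3_def)
    moreover have "0 < e\<^sup>2" using e_pos by simp
    ultimately show False by (simp add: power_mult_distrib power_divide)
  qed
  then obtain \<eta> where \<eta>: "\<eta> > 0" "\<And>a. a \<in> K3 \<Longrightarrow> e + \<eta> \<le> cmod a"
    using compact_norm_gap[OF cK(3)] by blast
  define h where "h = min (e / 4) (min (\<eta> / 4) (r / 4))"
  have h: "0 < h" "h \<le> e / 4" "h \<le> \<eta> / 4" "h \<le> r / 4"
    using \<eta> \<open>0 < r\<close> e_pos by (auto simp: h_def)
  have zeroX: "infdist 0 X = e" if "compact X" "X \<subseteq> K \<or> X \<subseteq> uminus ` K" "Complex 0 e \<in> X" for X
  proof -
    have ne: "X \<noteq> {}" using that by auto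
    note infX = infdist_less_iff[OF compact_imp_closed[OF that(1)] ne]
    show ?thesis
      using infX(3)[of 0 e] infX(4)[of e 0] that(2,3) norm_ge e_pos
      by (intro antisym) (auto intro!: bexI[of _ "Complex 0 e"] simp: dist_norm cmod_def)
  qed
  have above1: "h < Im a" if "a \<in> K1" for a
    using that h e_pos by (auto simp: K1_def)
  have "K1 \<noteq> {}" using K1 by auto
  have zero1: "infdist 0 K1 = e"
    by (rule zeroX) (use cK K1 in \<open>auto simp: K1_def\<close>)
  note inf1 = infdist_less_iff[OF compact_imp_closed[OF cK(1)] \<open>K1 \<noteq> {}\<close>]
  obtain \<delta>1 f where f: "\<delta>1 > 0" "continuous_on {-\<delta>1..\<delta>1} f" "f 0 = 0" "\<And>x. \<bar>x\<bar> \<le> \<delta>1 \<Longrightarrow> \<bar>f x\<bar> < h"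
    "\<And>x y. \<bar>x\<bar> \<le> \<delta>1 \<Longrightarrow> \<bar>y\<bar> \<le> h \<Longrightarrow> infdist (Complex x y) K1 < e \<longleftrightarrow> f x < y"
    "\<And>x y. \<bar>x\<bar> \<le> \<delta>1 \<Longrightarrow> \<bar>y\<bar> \<le> h \<Longrightarrow> e < infdist (Complex x y) K1 \<longleftrightarrow> y < f x"
    by (rule level_set_is_graph[OF cK(1) \<open>K1 \<noteq> {}\<close> e_pos h(1) above1 zero1]) blast+
  have "compact (uminus ` K2)" using cK(2) by (rule compact_negations)
  have above2: "h < Im a" if "a \<in> uminus ` K2" for a
    using that h e_pos by (auto simp: K2_def)
  have mK2: "Complex 0 e \<in> uminus ` K2" using K2 by (force simp: complex_eq_iff image_iff intro: bexI[of _ "Complex 0 (-e)"])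
  then have "uminus ` K2 \<noteq> {}" "K2 \<noteq> {}" by auto
  have zero2: "infdist 0 (uminus ` K2) = e"
    by (rule zeroX) (use \<open>compact (uminus ` K2)\<close> mK2 in \<open>auto simp: K2_def\<close>)
  note inf2' = infdist_less_iff[OF compact_imp_closed[OF \<open>compact (uminus ` K2)\<close>] \<open>uminus ` K2 \<noteq> {}\<close>]
  note inf2 = infdist_less_iff[OF compact_imp_closed[OF cK(2)] \<open>K2 \<noteq> {}\<close>]
  obtain \<delta>2 f' where f': "\<delta>2 > 0" "continuous_on {-\<delta>2..\<delta>2} f'" "f' 0 = 0" "\<And>x. \<bar>x\<bar> \<le> \<delta>2 \<Longrightarrow> \<bar>f' x\<bar> < h"
    "\<And>x y. \<bar>x\<bar> \<le> \<delta>2 \<Longrightarrow> \<bar>y\<bar> \<le> h \<Longrightarrow> infdist (Complex x y) (uminus ` K2) < e \<longleftrightarrow> f' x < y"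
    "\<And>x y. \<bar>x\<bar> \<le> \<delta>2 \<Longrightarrow> \<bar>y\<bar> \<le> h \<Longrightarrow> e < infdist (Complex x y) (uminus ` K2) \<longleftrightarrow> y < f' x"
    by (rule level_set_is_graph[OF \<open>compact (uminus ` K2)\<close> \<open>uminus ` K2 \<noteq> {}\<close> e_pos h(1) above2 zero2]) blast+
  \<comment> \<open>\<open>K2\<close> lies below the axis, so the graph lemma was applied to its
    reflection in 0; \<open>g\<close> reflects the graph back.\<close>
  define g where "g x = - f' (- x)" for x
  have neg: "infdist (Complex (-x) (-y)) (uminus ` K2) < e \<longleftrightarrow> infdist (Complex x y) K2 < e"
    "e < infdist (Complex (-x) (-y)) (uminus ` K2) \<longleftrightarrow> e < infdist (Complex x y) K2" for x y
    unfolding inf2 inf2' ball_simps bex_simps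
    by (simp_all add: dist_norm complex_minus[symmetric] norm_minus_commute del: complex_minus)
  define \<delta> where "\<delta> = min (min \<delta>1 \<delta>2) (min (e / 4) (min (\<eta> / 4) (r / 4)))"
  have \<delta>: "0 < \<delta>" "\<delta> \<le> \<delta>1" "\<delta> \<le> \<delta>2" "\<delta> \<le> e / 4" "\<delta> \<le> \<eta> / 4" "\<delta> \<le> r / 4"
    using f(1) f'(1) \<eta> \<open>0 < r\<close> e_pos by (auto simp: \<delta>_def)
  have f_less: "infdist (Complex x y) K1 < e \<longleftrightarrow> f x < y" and f_gt: "e < infdist (Complex x y) K1 \<longleftrightarrow> y < f x"
    and g_less: "infdist (Complex x y) K2 < e \<longleftrightarrow> y < g x" and g_gt: "e < infdist (Complex x y) K2 \<longleftrightarrow> g x < y"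
    if "\<bar>x\<bar> \<le> \<delta>" "\<bar>y\<bar> \<le> h" for x y
    using f(5,6)[of x y] f'(5,6)[of "-x" "-y"] that \<delta> unfolding neg g_def by auto
  have fh: "- h < f x \<and> f x < h" and gh: "- h < g x \<and> g x < h" if "- \<delta> \<le> x" "x \<le> \<delta>" for x
    using f(4)[of x] f'(4)[of "-x"] that \<delta> by (auto simp: g_def abs_less_iff abs_le_iff)
  have cont_f: "continuous_on {-\<delta>..\<delta>} f"
    by (rule continuous_on_subset[OF f(2)]) (use \<delta> in auto)
  have cont_g: "continuous_on {-\<delta>..\<delta>} g"
    unfolding g_def
    by (intro continuous_intros continuous_on_compose2[OF f'(2)]) (use \<delta> in auto)
  have g0: "g 0 = 0" using f'(3) by (simp add: g_def)
  have small: "cmod (Complex x y) \<le> \<bar>x\<bar> + \<bar>y\<bar>" for x y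
    using cmod_le[of "Complex x y"] by simp
  \<comment> \<open>Conversely, a point between the graphs is outside both tangent discs, and
    flatness gives \<open>\<bar>y\<bar> \<le> x\<close>. Points of \<open>K3\<close> are excluded by
    the margin \<open>\<eta>\<close>; those of \<open>K\<close> further left make an obtuse angle
    with \<open>Complex x y\<close>, so their distance exceeds their norm.\<close>
  have far_iff: "e < infdist (Complex x y) K \<longleftrightarrow> g x < y \<and> y < f x" if xy: "0 < x" "x \<le> \<delta>" "\<bar>y\<bar> \<le> h" for x y
  proof
    assume "e < infdist (Complex x y) K"
    then have "e < infdist (Complex x y) K1" "e < infdist (Complex x y) K2"
      unfolding infdist_iff inf1 inf2 by (auto simp: K1_def K2_def)
    then show "g x < y \<and> y < f x" using f_gt[of x y] g_gt[of x y] xy by auto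
  next
    assume "g x < y \<and> y < f x"
    then have far12: "e < dist (Complex x y) a" if "a \<in> K1 \<union> K2" for a
      using f_gt[of x y] g_gt[of x y] xy that unfolding inf1 inf2 by auto
    have "2 * (e * \<bar>y\<bar>) < x\<^sup>2 + y\<^sup>2"
      using antipodal_far_imp_flat[OF e_pos] far12 K1 K2 by blast
    moreover have "x\<^sup>2 \<le> (e * x) / 4" "y\<^sup>2 \<le> (e * \<bar>y\<bar>) / 4"
      using xy \<delta>(4) h(2) mult_right_mono[of x "e / 4" x] mult_right_mono[of "\<bar>y\<bar>" "e / 4" "\<bar>y\<bar>"]
      by (auto simp: power2_eq_square)
    moreover have "0 \<le> e * x" "0 \<le> e * \<bar>y\<bar>" using e_pos xy(1) by auto
    ultimately have "e * \<bar>y\<bar> \<le> e * x" by linarith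
    then have yx: "\<bar>y\<bar> \<le> x" using e_pos by simp
    have "e < dist (Complex x y) a" if a: "a \<in> K" "a \<notin> K1 \<union> K2" for a
    proof (cases "a \<in> K3")
      case True
      have "cmod a \<le> cmod (Complex x y) + dist (Complex x y) a"
        by (metis dist_norm norm_minus_commute norm_triangle_sub)
      then show ?thesis
        using small[of x y] \<eta>(2)[OF True] \<eta>(1) xy \<delta>(5) h(3) by linarith
    next
      case False
      then have ra: "Re a < - (3 / 5) * e" "\<bar>Im a\<bar> \<le> e / 2"
        using a by (auto simp: K1_def K2_def K3_def)
      have "x * Re a \<le> x * (- (3 / 5) * e)" using ra xy by (intro mult_left_mono) auto
      moreover have "\<bar>y * Im a\<bar> \<le> x * (e / 2)"
        unfolding abs_mult using ra yx by (intro mult_mono) auto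
      moreover have "0 < x * e" using xy e_pos by simp
      ultimately have inner: "x * Re a + y * Im a < 0" by (simp add: algebra_simps)
      have expand: "(x - Re a)\<^sup>2 + (y - Im a)\<^sup>2 = x\<^sup>2 + y\<^sup>2 + ((Re a)\<^sup>2 + (Im a)\<^sup>2) - 2 * (x * Re a + y * Im a)"
        by (simp add: power2_eq_square algebra_simps)
      have "e\<^sup>2 < (x - Re a)\<^sup>2 + (y - Im a)\<^sup>2"
        unfolding expand using norm_ge'[OF a(1)] inner zero_le_power2[of x] zero_le_power2[of y] by argo
      then show ?thesis
        unfolding dist_less_iff_square[OF e_pos] by simp
    qed
    then show "e < infdist (Complex x y) K"
      unfolding infdist_iff using far12 by blast
  qed
  obtain z0 where z0: "z0 \<in> D" "0 < Re z0" "cmod z0 < min \<delta> h"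
    using accumE[of "min \<delta> h"] \<delta> h by auto
  define x0 where "x0 = Re z0"
  have x0: "0 < x0" "x0 < \<delta>" "\<bar>Im z0\<bar> < h"
    using z0 abs_Re_le_cmod[of z0] abs_Im_le_cmod[of z0] by (auto simp: x0_def)
  \<comment> \<open>If the gap closed at \<open>t\<close>, then \<open>D\<close>, having points
    inside and outside the box \<open>T\<close>, would cross its frontier: not on the left side by
    flatness, not on the horizontal sides because the graphs stay within \<open>h\<close>, and not
    at \<open>Re w = t\<close> by assumption.\<close>
  have gap: "g t < f t" if t: "0 < t" "t < x0" for t
  proof (rule ccontr)
    assume closed_gap: "\<not> g t < f t"
    define T where "T = {z. 0 < Re z \<and> Re z < t \<and> - h < Im z \<and> Im z < h}"
    obtain z1 where z1: "z1 \<in> D" "0 < Re z1" "cmod z1 < min t h"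
      using accumE[of "min t h"] t h by auto
    then have "z1 \<in> T"
      using abs_Re_le_cmod[of z1] abs_Im_le_cmod[of z1] by (auto simp: T_def)
    moreover have "z0 \<notin> T" using t by (auto simp: T_def x0_def)
    ultimately have "D \<inter> frontier T \<noteq> {}"
      using connected_Int_frontier[OF connected_D] z0 z1 by blast
    then obtain w where w: "w \<in> D" "w \<in> frontier T" by blast
    have "open T"
      unfolding T_def by (intro open_Collect_conj open_Collect_less continuous_intros)
    then have "w \<notin> T" "w \<in> closure T" using w(2) by (auto simp: frontier_def interior_open)
    have "closure T \<subseteq> {z. 0 \<le> Re z \<and> Re z \<le> t \<and> - h \<le> Im z \<and> Im z \<le> h}"
      by (rule closure_minimal) (auto simp: T_def intro!: closed_Collect_conj closed_Collect_le continuous_on_Re continuous_on_Im continuous_on_id continuous_on_const)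
    then have wT: "0 \<le> Re w" "Re w \<le> t" "- h \<le> Im w" "Im w \<le> h"
      using \<open>w \<in> closure T\<close> by auto
    have dw: "e < infdist w K" using D_far w by blast
    show False
    proof (cases "Re w = 0")
      case True
      have "2 * (e * \<bar>Im w\<bar>) < (Re w)\<^sup>2 + (Im w)\<^sup>2"
        using flat[of "Re w" "Im w"] dw unfolding infdist_iff by simp
      then have "2 * (e * \<bar>Im w\<bar>) < (Im w)\<^sup>2" by (simp add: True)
      moreover have "(Im w)\<^sup>2 \<le> e * \<bar>Im w\<bar>"
        using wT h(2) e_pos mult_right_mono[of "\<bar>Im w\<bar>" e "\<bar>Im w\<bar>"] by (auto simp: power2_eq_square)
      moreover have "0 \<le> e * \<bar>Im w\<bar>" using e_pos by simp
      ultimately show False by linarith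
    next
      case False
      then have "g (Re w) < Im w \<and> Im w < f (Re w)"
        using far_iff[of "Re w" "Im w"] dw wT t x0 by auto
      moreover have "f (Re w) < h" "- h < g (Re w)"
        using fh[of "Re w"] gh[of "Re w"] wT t x0 by auto
      ultimately show False
        using \<open>w \<notin> T\<close> False wT closed_gap by (auto simp: T_def)
    qed
  qed
  define R where "R = {z. 0 < Re z \<and> Re z < x0 \<and> g (Re z) < Im z \<and> Im z < f (Re z)}"
  have "connected R"
    unfolding R_def
    by (rule connected_between_graphs)
      (use x0 gap in \<open>auto intro: continuous_on_subset[OF cont_f] continuous_on_subset[OF cont_g]\<close>)
  define s where "s = min x0 h"
  have "0 < s" using x0 h by (simp add: s_def)
  have box: "\<bar>Re z\<bar> < x0 \<and> \<bar>Im z\<bar> < h" if "z \<in> ball 0 s" for z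
    using that abs_Re_le_cmod[of z] abs_Im_le_cmod[of z] by (auto simp: s_def)
  obtain z where z: "z \<in> D" "0 < Re z" "z \<in> ball 0 s"
    using accumE[OF \<open>0 < s\<close>] by auto
  have "R \<subseteq> D"
  proof (rule D_maximal[OF \<open>connected R\<close> _ _ \<open>z \<in> D\<close>])
    show "z \<in> R"
      using box[OF z(3)] D_far[OF z(1)] far_iff[of "Re z" "Im z"] z(2) x0 by (auto simp: R_def)
    show "e < infdist w K" if "w \<in> R" for w
    proof -
      have "0 < Re w" "Re w \<le> \<delta>" "\<bar>Im w\<bar> \<le> h" "g (Re w) < Im w \<and> Im w < f (Re w)"
        using that fh[of "Re w"] gh[of "Re w"] x0 by (auto simp: R_def)
      then show ?thesis using far_iff[of "Re w" "Im w"] by simp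
    qed
  qed
  have graphs: "Complex x (f x) \<in> frontier D \<inter> ball 0 r" "Complex x (g x) \<in> frontier D \<inter> ball 0 r" 
    if x: "0 \<le> x" "x < x0" for x
  proof -
    have b: "\<bar>f x\<bar> < h" "\<bar>g x\<bar> < h" using fh[of x] gh[of x] x x0 by (auto simp: abs_less_iff)
    have "Complex x (f x) \<in> ball 0 r" "Complex x (g x) \<in> ball 0 r"
      using small[of x "f x"] small[of x "g x"] b x x0 \<delta>(6) h(4) \<open>0 < r\<close> by auto
    moreover have "Complex x (f x) \<in> frontier D \<and> Complex x (g x) \<in> frontier D"
    proof (cases "x = 0")
      case True
      then show ?thesis using zero f(3) g0 by (simp flip: zero_complex.code)
    next
      case False
      have in_D: "Complex x y \<in> D" if "g x < y" "y < f x" for y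
        using that False x \<open>R \<subseteq> D\<close> by (auto simp: R_def)
      have "g x < f x" using gap x False by auto
      then have "Complex x (f x) \<in> closure D" "Complex x (g x) \<in> closure D"
        using vertical_ends_in_closure[of "g x" "f x" x D] in_D by auto
      then show ?thesis
        using far_iff[of x "f x"] far_iff[of x "g x"] b x x0 False by (auto intro!: frontierI)
    qed
    ultimately show "Complex x (f x) \<in> frontier D \<inter> ball 0 r" "Complex x (g x) \<in> frontier D \<inter> ball 0 r"
      by auto
  qed
  show ?thesis
  proof (rule exI[of _ s], intro conjI ballI impI)
    show "0 < s" by fact
    fix q assume q: "q \<in> frontier D \<inter> ball 0 s" and "0 < Re q"
    then have bq: "Re q < x0" "\<bar>Re q\<bar> \<le> \<delta>" "\<bar>Im q\<bar> \<le> h" using box[of q] x0 by auto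
    have iq: "infdist q K = e" using frontier_infdist q by blast
    \<comment> \<open>At distance exactly \<open>e\<close>, the point \<open>q\<close> lies weakly
      between the graphs but not strictly, hence on one of them.\<close>
    have "\<not> infdist q K1 < e" "\<not> infdist q K2 < e"
      using iq infdist_iff(1)[of q e] unfolding inf1 inf2 by (auto simp: K1_def K2_def)
    then have "Im q \<le> f (Re q)" "g (Re q) \<le> Im q"
      using f_less[of "Re q" "Im q"] g_less[of "Re q" "Im q"] bq by auto
    moreover have "\<not> (g (Re q) < Im q \<and> Im q < f (Re q))"
      using far_iff[of "Re q" "Im q"] iq bq \<open>0 < Re q\<close> by auto
    ultimately have "Im q = f (Re q) \<or> Im q = g (Re q)" by auto
    then have q_eq: "q = Complex (Re q) (f (Re q)) \<or> q = Complex (Re q) (g (Re q))"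
      by (auto simp: complex_eq_iff)
    have seg: "0 \<le> t \<and> t < x0" if "t \<in> closed_segment 0 (Re q)" for t
      using that bq \<open>0 < Re q\<close> by (auto simp: closed_segment_eq_real_ivl)
    then have sub: "closed_segment 0 (Re q) \<subseteq> {-\<delta>..\<delta>}" using x0 by force
    have "\<exists>g. path g \<and> path_image g \<subseteq> frontier D \<inter> ball 0 r \<and> pathstart g = 0 \<and> pathfinish g = Complex (Re q) (f (Re q))"
      by (rule path_along_graph[OF continuous_on_subset[OF cont_f sub] f(3)]) (use seg graphs in blast)
    moreover have "\<exists>h. path h \<and> path_image h \<subseteq> frontier D \<inter> ball 0 r \<and> pathstart h = 0 \<and> pathfinish h = Complex (Re q) (g (Re q))"
      by (rule path_along_graph[OF continuous_on_subset[OF cont_g sub] g0]) (use seg graphs in blast)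
    ultimately show "\<exists>g. path g \<and> path_image g \<subseteq> frontier D \<inter> ball 0 r \<and> pathstart g = 0 \<and> pathfinish g = q"
      using q_eq by metis
  qed
qed

end

section \<open>Transport by plane isometries\<close>

lemma components_image_homeomorphism:
  assumes hom: "homeomorphism S T f g" and "C \<in> components S"
  shows "f ` C \<in> components T"
proof -
  have C: "C \<noteq> {}" "C \<subseteq> S" "connected C" "\<And>D. D \<noteq> {} \<Longrightarrow> C \<subseteq> D \<Longrightarrow> D \<subseteq> S \<Longrightarrow> connected D \<Longrightarrow> D = C"
    using assms(2) unfolding in_components_maximal by auto
  have fg: "f ` S = T" "g ` T = S" "continuous_on S f" "continuous_on T g"
    "\<And>x. x \<in> S \<Longrightarrow> g (f x) = x" "\<And>y. y \<in> T \<Longrightarrow> f (g y) = y"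
    using hom by (auto simp: homeomorphism_def)
  show ?thesis
    unfolding in_components_maximal
  proof (intro conjI allI impI)
    show "f ` C \<noteq> {}" "f ` C \<subseteq> T" using C fg by auto
    show "connected (f ` C)"
      using C fg(3) by (meson connected_continuous_image continuous_on_subset)
    fix E assume E: "E \<noteq> {} \<and> f ` C \<subseteq> E \<and> E \<subseteq> T \<and> connected E"
    have "g ` E = C"
    proof (rule C(4))
      show "connected (g ` E)"
        using E fg(4) by (meson connected_continuous_image continuous_on_subset)
      show "C \<subseteq> g ` E"
      proof
        fix x assume "x \<in> C"
        then have "f x \<in> E" "g (f x) = x" using E C(2) fg(5) by auto
        then show "x \<in> g ` E" by (metis image_eqI)
      qed
    qed (use E fg in auto)
    moreover have "f ` (g ` E) = E"
      using E fg(6) by (force simp: image_image)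
    ultimately show "E = f ` C" by simp
  qed
qed

lemma infdist_isometry_image:
  assumes "\<And>x y. dist (T x) (T y) = dist x y"
  shows "infdist (T z) (T ` K) = infdist z K"
  by (simp add: infdist_def image_image assms)

text \<open>The explicit inverse \<open>T'\<close> pulls paths back. The instances are rotations
  about 0, translations and the reflection in 0.\<close>

locale plane_isometry =
  fixes T T' :: "complex \<Rightarrow> complex"
  assumes isom: "dist (T x) (T y) = dist x y"
    and inv: "T' (T x) = x" "T (T' x) = x"
begin

lemma isom': "dist (T' x) (T' y) = dist x y"
  by (metis isom inv(2))

lemma continuous: "continuous_on S T" "continuous_on S T'"
  by (auto simp: continuous_on_iff isom isom')

lemma homeomorphism: "homeomorphism S (T ` S) T T'"
  by (auto simp: homeomorphism_def inv continuous image_image)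

lemma distance_component_image:
  assumes "distance_component K e D"
  shows "distance_component (T ` K) e (T ` D)"
proof -
  interpret distance_component K e D by fact
  have "T ` {z. e < infdist z K} = {z. e < infdist z (T ` K)}"
  proof (intro set_eqI iffI)
    fix z assume "z \<in> {z. e < infdist z (T ` K)}"
    then have "e < infdist (T' z) K"
      using infdist_isometry_image[of T "T' z" K, OF isom] by (simp add: inv)
    then show "z \<in> T ` {z. e < infdist z K}"
      by (intro image_eqI[of _ _ "T' z"]) (simp_all add: inv)
  qed (auto simp: infdist_isometry_image isom)
  then show ?thesis
    using components_image_homeomorphism[OF homeomorphism component] compact_K nonempty_K e_pos
    by unfold_locales (auto intro: compact_continuous_image continuous)
qed

lemma frontier_image: "frontier (T ` D) = T ` frontier D"
proof -
  have "homeomorphic_maps euclidean euclidean T T'"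
    by (simp add: homeomorphic_maps_def continuous inv)
  then have "homeomorphic_map euclidean euclidean T"
    by (auto simp: homeomorphic_map_maps)
  from homeomorphic_map_frontier_of[OF this, of D] show ?thesis by simp
qed

text \<open>The direction is from the normalised image back to the original set: paths are composed
  with \<open>T'\<close>.\<close>

lemma im_kleinen_image:
  assumes "path_connected_im_kleinen_at (T ` S) (T p)"
  shows "path_connected_im_kleinen_at S p"
  unfolding path_connected_im_kleinen_at_def
proof (intro allI impI)
  fix r :: real assume "0 < r"
  with assms obtain s where s: "s > 0" "\<And>q. q \<in> T ` S \<inter> ball (T p) s \<Longrightarrow>
      \<exists>g. path g \<and> path_image g \<subseteq> T ` S \<inter> ball (T p) r \<and> pathstart g = T p \<and> pathfinish g = q"
    unfolding path_connected_im_kleinen_at_def by meson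
  have "\<exists>g. path g \<and> path_image g \<subseteq> S \<inter> ball p r \<and> pathstart g = p \<and> pathfinish g = q"
    if q: "q \<in> S \<inter> ball p s" for q
  proof -
    obtain g where g: "path g" "path_image g \<subseteq> T ` S \<inter> ball (T p) r" "pathstart g = T p" "pathfinish g = T q"
      using s(2)[of "T q"] q by (auto simp: isom)
    have "path_image (T' \<circ> g) \<subseteq> S \<inter> ball p r"
    proof
      fix z assume "z \<in> path_image (T' \<circ> g)"
      then obtain w where w: "w \<in> path_image g" "z = T' w" by (auto simp: path_image_compose)
      then have "w \<in> T ` S \<inter> ball (T p) r" using g(2) by blast
      then obtain x where "x \<in> S" "w = T x" "dist (T p) (T x) < r" by auto
      then show "z \<in> S \<inter> ball p r" using w by (simp add: inv isom)
    qed
    then show ?thesis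
      using g by (intro exI[of _ "T' \<circ> g"])
        (auto simp: path_continuous_image continuous pathstart_compose pathfinish_compose inv)
  qed
  with s(1) show "\<exists>s>0. \<forall>q\<in>S \<inter> ball p s. \<exists>g. path g \<and> path_image g \<subseteq> S \<inter> ball p r \<and> pathstart g = p \<and> pathfinish g = q"
    by blast
qed

end

lemma plane_isometry_rotate: "cmod u = 1 \<Longrightarrow> plane_isometry (\<lambda>z. u * z) (\<lambda>z. z / u)"
  by unfold_locales (auto simp: dist_norm norm_mult simp flip: right_diff_distrib)

lemma plane_isometry_translate: "plane_isometry (\<lambda>z. z - p) (\<lambda>z. z + p)"
  by unfold_locales (auto simp: dist_norm)

section \<open>Reduction of a frontier point to normal position\<close>

context distance_component
begin

text \<open>The right half plane is handled by \<open>right_cusp\<close>, the left one by the same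
  argument after reflection in 0. On the imaginary axis 0 is the only frontier point of norm below
  \<open>e\<close>.\<close>

lemma im_kleinen_if_vertical_antipodal:
  assumes zero: "0 \<in> frontier D" and antipodal: "Complex 0 e \<in> K" "Complex 0 (-e) \<in> K"
  shows "path_connected_im_kleinen_at (frontier D) 0"
  unfolding path_connected_im_kleinen_at_def
proof (intro allI impI)
  fix r :: real assume "0 < r"
  have norm_ge: "e \<le> cmod a" if "a \<in> K" for a
    using frontier_infdist[OF zero] infdist_iff(4)[of e 0] that by auto
  interpret neg: plane_isometry uminus uminus
    by unfold_locales (auto simp: dist_norm norm_minus_commute)
  have side: "\<exists>s>0. \<forall>q\<in>frontier E \<inter> ball 0 s. 0 < Re q \<longrightarrow>
     (\<exists>g. path g \<and> path_image g \<subseteq> frontier E \<inter> ball 0 r \<and> pathstart g = 0 \<and> pathfinish g = q)"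
    if E: "distance_component L e E" "Complex 0 e \<in> L" "Complex 0 (-e) \<in> L" "\<And>a. a \<in> L \<Longrightarrow> e \<le> cmod a" for L E
  proof (cases "0 \<in> closure (E \<inter> {z. 0 < Re z})")
    case True
    then show ?thesis using distance_component.right_cusp[OF E _ \<open>0 < r\<close>] by blast
  next
    case False
    then obtain s where s: "s > 0" "\<And>z. z \<in> E \<Longrightarrow> 0 < Re z \<Longrightarrow> s \<le> cmod z"
      unfolding closure_approachable by (force simp: dist_norm not_less)
    have False if q: "q \<in> frontier E" "q \<in> ball 0 s" "0 < Re q" for q
    proof -
      \<comment> \<open>An open half disc that misses \<open>D\<close> also misses its closure, so
        this side contributes no frontier points near 0.\<close>
      have "open (ball 0 s \<inter> {z. 0 < Re z})"
        by (intro open_Int open_ball open_Collect_less continuous_intros)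
      moreover have "q \<in> closure E" using q by (simp add: frontier_def)
      ultimately have "ball 0 s \<inter> {z. 0 < Re z} \<inter> E \<noteq> {}"
        using q open_Int_closure_eq_empty[of "ball 0 s \<inter> {z. 0 < Re z}" E] by blast
      then show False using s(2) by fastforce
    qed
    then show ?thesis using s(1) by blast
  qed
  obtain s1 where s1: "s1 > 0" "\<And>q. q\<in>frontier D \<inter> ball 0 s1 \<Longrightarrow> 0 < Re q \<Longrightarrow>
     (\<exists>g. path g \<and> path_image g \<subseteq> frontier D \<inter> ball 0 r \<and> pathstart g = 0 \<and> pathfinish g = q)"
    using side[OF distance_component_axioms antipodal norm_ge] by blast
  have "Complex 0 e \<in> uminus ` K" "Complex 0 (-e) \<in> uminus ` K"
    using antipodal by (auto simp: image_iff complex_eq_iff intro: bexI[of _ "Complex 0 e"] bexI[of _ "Complex 0 (-e)"])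
  moreover have "e \<le> cmod a" if "a \<in> uminus ` K" for a using that norm_ge by auto
  ultimately obtain s2 where s2: "s2 > 0" "\<And>q. q\<in>frontier (uminus ` D) \<inter> ball 0 s2 \<Longrightarrow> 0 < Re q \<Longrightarrow>
     (\<exists>g. path g \<and> path_image g \<subseteq> frontier (uminus ` D) \<inter> ball 0 r \<and> pathstart g = 0 \<and> pathfinish g = q)"
    using side[OF neg.distance_component_image[OF distance_component_axioms]] by blast
  have left: "\<exists>g. path g \<and> path_image g \<subseteq> frontier D \<inter> ball 0 r \<and> pathstart g = 0 \<and> pathfinish g = q"
    if q: "q \<in> frontier D \<inter> ball 0 s2" "Re q < 0" for q
  proof -
    obtain g where g: "path g" "path_image g \<subseteq> uminus ` frontier D \<inter> ball 0 r" "pathstart g = 0" "pathfinish g = -q"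
      using s2(2)[of "-q"] q by (auto simp: neg.frontier_image)
    have "path_image (uminus \<circ> g) \<subseteq> frontier D \<inter> ball 0 r"
      using g(2) by (force simp: path_image_compose)
    then show ?thesis
      using g by (intro exI[of _ "uminus \<circ> g"])
        (auto simp: path_continuous_image neg.continuous pathstart_compose pathfinish_compose)
  qed
  have mid: "q = 0" if q: "q \<in> frontier D" "cmod q < e" "Re q = 0" for q
  proof (rule ccontr)
    assume "q \<noteq> 0"
    then have "Im q \<noteq> 0" using q by (simp add: complex_eq_iff)
    have "\<bar>Im q\<bar> < e" using q abs_Im_le_cmod[of q] by linarith
    have "dist q (Complex 0 e) < e \<or> dist q (Complex 0 (-e)) < e"
      using q(3) \<open>Im q \<noteq> 0\<close> \<open>\<bar>Im q\<bar> < e\<close> by (simp add: dist_norm cmod_def) linarith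
    then have "infdist q K < e" unfolding infdist_iff using antipodal by blast
    then show False using frontier_infdist[OF q(1)] by simp
  qed
  have trivial: "\<exists>g. path g \<and> path_image g \<subseteq> frontier D \<inter> ball 0 r \<and> pathstart g = 0 \<and> pathfinish g = 0"
    using zero \<open>0 < r\<close> by (intro exI[of _ "linepath 0 0"]) auto
  show "\<exists>s>0. \<forall>q\<in>frontier D \<inter> ball 0 s. \<exists>g. path g \<and> path_image g \<subseteq> frontier D \<inter> ball 0 r \<and> pathstart g = 0 \<and> pathfinish g = q"
  proof (rule exI[of _ "min e (min s1 s2)"], intro conjI ballI)
    show "0 < min e (min s1 s2)" using e_pos s1 s2 by simp
    fix q assume q: "q \<in> frontier D \<inter> ball 0 (min e (min s1 s2))"
    consider "0 < Re q" | "Re q < 0" | "Re q = 0" by linarith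
    then show "\<exists>g. path g \<and> path_image g \<subseteq> frontier D \<inter> ball 0 r \<and> pathstart g = 0 \<and> pathfinish g = q"
    proof cases
      case 1 then show ?thesis using s1(2)[of q] q by auto
    next
      case 2 then show ?thesis using left[of q] q by auto
    next
      case 3 then show ?thesis using mid[of q] q trivial by auto
    qed
  qed
qed

text \<open>\<open>u\<close> is a limit direction of points \<open>z n\<close> of \<open>D\<close>
  tending to 0. From \<open>dist (z n) a > e = cmod a\<close> follows
  \<open>2 * (z n \<bullet> a) < (cmod (z n))\<^sup>2\<close>; divide by \<open>cmod (z n)\<close>
  and pass to the limit.\<close>

lemma near_points_in_half_plane:
  assumes zero: "0 \<in> frontier D"
  obtains u where "cmod u = 1" "\<And>a. a \<in> K \<Longrightarrow> cmod a = e \<Longrightarrow> u \<bullet> a \<le> 0"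
proof -
  have "0 \<in> closure D" using zero by (simp add: frontier_def)
  then have "\<exists>z\<in>D. cmod z < inverse (real (Suc n))" for n
    unfolding closure_approachable by (simp add: dist_norm)
  then obtain z where z: "\<And>n. z n \<in> D" "\<And>n. cmod (z n) < inverse (real (Suc n))" by metis
  have z0: "(\<lambda>n. cmod (z n)) \<longlonglongrightarrow> 0"
    by (rule tendsto_sandwich[OF _ _ tendsto_const LIMSEQ_inverse_real_of_nat])
       (use z(2) in \<open>auto intro!: always_eventually less_imp_le simp del: of_nat_Suc\<close>)
  have inf0: "infdist 0 K = e" using frontier_infdist[OF zero] .
  have nz: "z n \<noteq> 0" for n using D_far[OF z(1)[of n]] inf0 by auto
  have "\<forall>n. sgn (z n) \<in> sphere 0 1" using nz by (simp add: norm_sgn)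
  then obtain u \<phi> where u: "u \<in> sphere 0 1" "strict_mono (\<phi> :: nat \<Rightarrow> nat)" "((\<lambda>n. sgn (z n)) \<circ> \<phi>) \<longlonglongrightarrow> u"
    using compact_sphere[of "0::complex" 1] unfolding compact_def by metis
  have "u \<bullet> a \<le> 0" if a: "a \<in> K" "cmod a = e" for a
  proof (rule LIMSEQ_le)
    show "(\<lambda>n. sgn (z (\<phi> n)) \<bullet> a) \<longlonglongrightarrow> u \<bullet> a"
      using u(3) by (intro tendsto_intros) (simp add: o_def)
    show "(\<lambda>n. cmod (z (\<phi> n)) / 2) \<longlonglongrightarrow> 0"
      using LIMSEQ_subseq_LIMSEQ[OF z0 u(2)] by (auto intro: tendsto_divide_zero simp: o_def)
    have "sgn (z n) \<bullet> a \<le> cmod (z n) / 2" for n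
    proof -
      have "e < dist (z n) a" using D_far[OF z(1)] a(1) unfolding infdist_iff by blast
      then have "e\<^sup>2 < (cmod (z n - a))\<^sup>2"
        using e_pos by (simp add: dist_norm power_strict_mono)
      then have "2 * (z n \<bullet> a) < (cmod (z n))\<^sup>2"
        using a(2) by (simp add: power2_norm_eq_inner inner_diff_left inner_diff_right inner_commute flip: power2_norm_eq_inner[of a])
      then have "(z n \<bullet> a) / cmod (z n) \<le> cmod (z n) / 2"
        using nz[of n] by (simp add: field_simps power2_eq_square)
      moreover have "sgn (z n) \<bullet> a = (z n \<bullet> a) / cmod (z n)"
        by (simp add: sgn_div_norm divide_inverse mult.commute)
      ultimately show ?thesis by (simp only:)
    qed
    then show "\<exists>N. \<forall>n\<ge>N. sgn (z (\<phi> n)) \<bullet> a \<le> cmod (z (\<phi> n)) / 2" by blast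
  qed
  then show thesis using that u(1) by auto
qed

text \<open>On the line orthogonal to \<open>u\<close> there are only two candidates for nearest
  points, and they are antipodal; so at most one, \<open>a0\<close>, occurs, and tilting
  \<open>u\<close> slightly away from it makes all inequalities strict.\<close>

lemma near_points_strictly_on_one_side:
  assumes zero: "0 \<in> frontier D"
    and no_antipodal: "\<And>a. a \<in> K \<Longrightarrow> - a \<in> K \<Longrightarrow> cmod a \<noteq> e"
  obtains v where "v \<noteq> 0" "\<And>a. a \<in> K \<Longrightarrow> cmod a = e \<Longrightarrow> v \<bullet> a < 0"
proof -
  obtain u where u: "cmod u = 1" "\<And>a. a \<in> K \<Longrightarrow> cmod a = e \<Longrightarrow> u \<bullet> a \<le> 0"
    using near_points_in_half_plane[OF zero] by blast
  have inf0: "infdist 0 K = e" using frontier_infdist[OF zero] .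
  obtain b where b: "b \<in> K" "cmod b = e"
    using infdist_iff(3)[of 0 e] infdist_iff(4)[of e 0] inf0 by force
  show thesis
  proof (cases "\<exists>a\<in>K. cmod a = e \<and> u \<bullet> a = 0")
    case False
    then have "u \<bullet> a < 0" if "a \<in> K" "cmod a = e" for a using u(2)[OF that] that by force
    moreover have "u \<noteq> 0" using u(1) by auto
    ultimately show thesis using that by blast
  next
    case True
    then obtain a0 where a0: "a0 \<in> K" "cmod a0 = e" "u \<bullet> a0 = 0" by blast
    have unique: "a = a0" if a: "a \<in> K" "cmod a = e" "u \<bullet> a = 0" for a
    proof -
      have "(a - a0) * (a + a0) = 0"
      proof -
        have 1: "Re u * Re a + Im u * Im a = 0" "Re u * Re a0 + Im u * Im a0 = 0"
          using a(3) a0(3) by (simp_all add: inner_complex_def)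
        have 2: "(Re a)\<^sup>2 + (Im a)\<^sup>2 = e\<^sup>2" "(Re a0)\<^sup>2 + (Im a0)\<^sup>2 = e\<^sup>2"
          using a(2) a0(2) norm_eq_iff_square(2)[OF e_pos] by auto
        have 3: "(Re u)\<^sup>2 + (Im u)\<^sup>2 = 1" using u(1) norm_eq_iff_square(2)[of 1 u] by simp
        have 4: "Re a * Im a0 = Im a * Re a0" using 1 3 by algebra
        have "Re ((a - a0) * (a + a0)) = 0" using 1 2 3 4 by simp algebra
        moreover have "Im ((a - a0) * (a + a0)) = 0" using 1 2 3 4 by simp algebra
        ultimately show ?thesis by (simp add: complex_eq_iff)
      qed
      then consider "a = a0" | "a0 = - a"
        unfolding mult_eq_0_iff right_minus_eq by (metis minus_unique)
      then show ?thesis using no_antipodal[of a] a a0 by cases auto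
    qed
    \<comment> \<open>The nearest points for which the tilt could do harm. \<open>a0\<close> is not
      among them, so \<open>u \<bullet> a\<close> has a negative upper bound on this compact set;
      \<open>c = 1\<close> serves when it is empty.\<close>
    define M where "M = K \<inter> sphere 0 e \<inter> {a. a0 \<bullet> a \<le> 0}"
    have "compact M"
      unfolding M_def by (intro compact_Int_closed compact_K closed_sphere closed_Collect_le continuous_intros)
    obtain c where c: "c > 0" "\<And>a. a \<in> M \<Longrightarrow> u \<bullet> a \<le> - c"
    proof (cases "M = {}")
      case True then show thesis using that[of 1] by auto
    next
      case False
      obtain m where m: "m \<in> M" "\<And>a. a \<in> M \<Longrightarrow> u \<bullet> a \<le> u \<bullet> m"
        using continuous_attains_sup[OF \<open>compact M\<close> False, of "\<lambda>a. u \<bullet> a"] continuous_on_inner[OF continuous_on_const continuous_on_id] by blast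
      have "a0 \<notin> M" using a0 e_pos by (auto simp: M_def power2_norm_eq_inner[symmetric] power_le_zero_eq)
      then have "u \<bullet> m < 0" using m(1) u(2)[of m] unique[of m] by (force simp: M_def)
      then show thesis using that[of "- (u \<bullet> m)"] m(2) by auto
    qed
    \<comment> \<open>Since \<open>\<bar>a0 \<bullet> a\<bar> \<le> e\<^sup>2\<close>, the tilt
      costs at most \<open>c / 2\<close> on \<open>M\<close>.\<close>
    define \<tau> where "\<tau> = c / (2 * e\<^sup>2)"
    have "\<tau> > 0" using c(1) e_pos by (simp add: \<tau>_def)
    have neg: "(u - \<tau> *\<^sub>R a0) \<bullet> a < 0" if a: "a \<in> K" "cmod a = e" for a
    proof (cases "0 < a0 \<bullet> a")
      case True
      then have "0 < \<tau> * (a0 \<bullet> a)" using \<open>\<tau> > 0\<close> by simp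
      then show ?thesis using u(2)[OF a] by (simp add: inner_diff_left)
    next
      case False
      then have "u \<bullet> a \<le> - c" using c(2)[of a] a by (auto simp: M_def)
      moreover have "- (a0 \<bullet> a) \<le> e * e"
        using Cauchy_Schwarz_ineq2[of a0 a] a a0 by (simp add: abs_le_iff)
      then have "\<tau> * - (a0 \<bullet> a) \<le> \<tau> * (e * e)" using \<open>\<tau> > 0\<close> by (intro mult_left_mono) auto
      moreover have "\<tau> * (e * e) = c / 2" using e_pos by (simp add: \<tau>_def power2_eq_square)
      ultimately show ?thesis using c(1) by (simp add: inner_diff_left)
    qed
    moreover have "u - \<tau> *\<^sub>R a0 \<noteq> 0" using neg[OF b] by auto
    ultimately show thesis using that by blast
  qed
qed

text \<open>Either two nearest points are antipodal or all lie in an open half plane; a rotation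
  brings each case to its normal position.\<close>

lemma im_kleinen_at_zero:
  assumes zero: "0 \<in> frontier D"
  shows "path_connected_im_kleinen_at (frontier D) 0"
proof (cases "\<exists>a\<in>K. - a \<in> K \<and> cmod a = e")
  case True
  then obtain a where a: "a \<in> K" "- a \<in> K" "cmod a = e" by blast
  define w where "w = Complex 0 e / a"
  have "a \<noteq> 0" using a e_pos by auto
  have "cmod w = 1" using a e_pos by (simp add: w_def norm_divide) (simp add: cmod_def)
  interpret rot: plane_isometry "\<lambda>z. w * z" "\<lambda>z. z / w"
    using \<open>cmod w = 1\<close> by (rule plane_isometry_rotate)
  interpret R: distance_component "(\<lambda>z. w * z) ` K" e "(\<lambda>z. w * z) ` D"
    by (rule rot.distance_component_image) (rule distance_component_axioms)
  have "w * a = Complex 0 e" "w * (- a) = Complex 0 (- e)"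
    using \<open>a \<noteq> 0\<close> by (auto simp: w_def complex_eq_iff)
  then have "Complex 0 e \<in> (\<lambda>z. w * z) ` K" "Complex 0 (- e) \<in> (\<lambda>z. w * z) ` K"
    using a by (metis image_eqI)+
  then have "path_connected_im_kleinen_at (frontier ((\<lambda>z. w * z) ` D)) 0"
    by (intro R.im_kleinen_if_vertical_antipodal) (use zero in \<open>auto simp: rot.frontier_image image_iff\<close>)
  then show ?thesis using rot.im_kleinen_image[of "frontier D" 0] by (simp add: rot.frontier_image)
next
  case False
  then obtain v where v: "v \<noteq> 0" "\<And>a. a \<in> K \<Longrightarrow> cmod a = e \<Longrightarrow> v \<bullet> a < 0"
    using near_points_strictly_on_one_side[OF zero] by blast
  \<comment> \<open>The rotation taking the direction of \<open>- v\<close> to \<open>\<i>\<close>,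
    so that \<open>v \<bullet> a < 0\<close> becomes \<open>0 < Im (w * a)\<close>.\<close>
  define w where "w = - \<i> * cnj v / cmod v"
  have "cmod w = 1" using v(1) by (simp add: w_def norm_divide norm_mult)
  have Im_w: "Im (w * a) = - (v \<bullet> a) / cmod v" for a
    by (simp add: w_def inner_complex_def Im_divide_of_real algebra_simps add_divide_distrib diff_divide_distrib)
  interpret rot: plane_isometry "\<lambda>z. w * z" "\<lambda>z. z / w"
    using \<open>cmod w = 1\<close> by (rule plane_isometry_rotate)
  interpret R: distance_component "(\<lambda>z. w * z) ` K" e "(\<lambda>z. w * z) ` D"
    by (rule rot.distance_component_image) (rule distance_component_axioms)
  have "path_connected_im_kleinen_at (frontier ((\<lambda>z. w * z) ` D)) 0"
  proof (rule R.im_kleinen_if_graph)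
    show "0 \<in> frontier ((\<lambda>z. w * z) ` D)" using zero by (auto simp: rot.frontier_image image_iff)
    show "0 < Im b" if b: "b \<in> (\<lambda>z. w * z) ` K" "cmod b = e" for b
    proof -
      obtain a where "a \<in> K" "b = w * a" using b by blast
      then have "v \<bullet> a < 0" "b = w * a" using v(2)[of a] b(2) \<open>cmod w = 1\<close> by (auto simp: norm_mult)
      then show ?thesis using v(1) Im_w[of a] by (simp add: divide_neg_pos del: times_complex.sel)
    qed
  qed
  then show ?thesis using rot.im_kleinen_image[of "frontier D" 0] by (simp add: rot.frontier_image)
qed

lemma im_kleinen_at_frontier:
  assumes "p \<in> frontier D"
  shows "path_connected_im_kleinen_at (frontier D) p"
proof -
  interpret tr: plane_isometry "\<lambda>z. z - p" "\<lambda>z. z + p"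
    by (rule plane_isometry_translate)
  interpret R: distance_component "(\<lambda>z. z - p) ` K" e "(\<lambda>z. z - p) ` D"
    by (rule tr.distance_component_image) (rule distance_component_axioms)
  have "0 \<in> frontier ((\<lambda>z. z - p) ` D)"
    unfolding tr.frontier_image using assms by (auto simp: image_iff)
  from R.im_kleinen_at_zero[OF this] show ?thesis
    using tr.im_kleinen_image[of "frontier D" p] by (simp add: tr.frontier_image)
qed

lemma locally_path_connected_frontier: "locally path_connected (frontier D)"
  unfolding locally_path_connected_im_kleinen
proof (intro allI impI)
  fix V p assume Vp: "openin (top_of_set (frontier D)) V \<and> p \<in> V"
  then obtain r where r: "r > 0" "ball p r \<inter> frontier D \<subseteq> V" and p: "p \<in> frontier D"
    by (metis openin_contains_ball openin_imp_subset subsetD)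
  obtain s where s: "s > 0" "\<And>q. q \<in> frontier D \<inter> ball p s \<Longrightarrow> 
      \<exists>g. path g \<and> path_image g \<subseteq> frontier D \<inter> ball p r \<and> pathstart g = p \<and> pathfinish g = q"
    using im_kleinen_at_frontier[OF p] r(1) unfolding path_connected_im_kleinen_at_def by meson
  show "\<exists>u. openin (top_of_set (frontier D)) u \<and> p \<in> u \<and> u \<subseteq> V \<and>
      (\<forall>y. y \<in> u \<longrightarrow> (\<exists>g. path g \<and> path_image g \<subseteq> V \<and> pathstart g = p \<and> pathfinish g = y))"
  proof (intro exI[of _ "frontier D \<inter> ball p (min r s)"] conjI allI impI)
    fix y assume "y \<in> frontier D \<inter> ball p (min r s)"
    then obtain g where "path g" "path_image g \<subseteq> frontier D \<inter> ball p r" "pathstart g = p" "pathfinish g = y"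
      using s(2)[of y] by auto
    then show "\<exists>g. path g \<and> path_image g \<subseteq> V \<and> pathstart g = p \<and> pathfinish g = y"
      using r(2) by blast
  qed (use r s p in \<open>auto simp: openin_open_Int\<close>)
qed

end

section \<open>The frontier is a Jordan curve\<close>

lemma infdist_closure: "infdist x (closure A) = infdist x A"
proof (cases "A = {}")
  case False
  have "infdist x A \<le> infdist x (closure A)"
  proof (rule ccontr)
    assume "\<not> ?thesis"
    then obtain y where y: "y \<in> closure A" "dist x y < infdist x A"
      using False cInf_lessD[of "dist x ` closure A" "infdist x A"] by (auto simp: infdist_notempty)
    have "infdist y A = 0" using y(1) False by (simp add: in_closure_iff_infdist_zero)
    then show False using infdist_triangle[of x A y] y(2) by simp
  qed
  moreover have "infdist x (closure A) \<le> infdist x A"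
    using False closure_subset by (rule infdist_mono[rotated])
  ultimately show ?thesis by simp
qed simp

text \<open>The midpoint of two consecutive chain points is closer than \<open>e\<close> to both, so
  their balls overlap.\<close>

lemma connected_chained_balls:
  assumes "delta_chained (2 * e) A" "0 < e"
  shows "connected (\<Union>a\<in>A. ball a e)" (is "connected ?U")
  unfolding connected_iff_connected_component
proof (intro ballI)
  fix x y assume "x \<in> ?U" "y \<in> ?U"
  then obtain p q where pq: "p \<in> A" "x \<in> ball p e" "q \<in> A" "y \<in> ball q e" by blast
  then obtain r n where r: "r (0::nat) = p" "r n = q" "\<And>i. i \<le> n \<Longrightarrow> r i \<in> A"
      "\<And>i. i < n \<Longrightarrow> dist (r i) (r (Suc i)) < 2 * e"
    using assms(1) unfolding delta_chained_def by metis
  have in_ball: "connected_component ?U u v" if "a \<in> A" "u \<in> ball a e" "v \<in> ball a e" for a u v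
    unfolding connected_component_def using that by (intro exI[of _ "ball a e"]) auto
  have "connected_component ?U p (r i)" if "i \<le> n" for i
    using that
  proof (induction i)
    case 0
    then show ?case using r(1) pq(1) assms(2) in_ball[of p p p] by simp
  next
    case (Suc i)
    let ?m = "midpoint (r i) (r (Suc i))"
    have "dist (r i) ?m < e" "dist (r (Suc i)) ?m < e"
      using r(4)[of i] Suc.prems by (auto simp: dist_midpoint)
    then have "connected_component ?U (r i) ?m" "connected_component ?U ?m (r (Suc i))"
      using in_ball[of "r i" "r i" ?m] in_ball[of "r (Suc i)" ?m "r (Suc i)"] r(3) Suc.prems assms(2) by auto
    then show ?case using Suc.IH Suc.prems by (meson Suc_leD connected_component_trans)
  qed
  from this[of n] have "connected_component ?U p q" using r(2) by simp
  moreover have "connected_component ?U x p" "connected_component ?U q y"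
    using in_ball pq assms(2) by auto
  ultimately show "connected_component ?U x y"
    by (meson connected_component_trans)
qed

text \<open>A connected set properly containing the inside or the outside would meet its frontier,
  the curve. So these two are components and exhaust the complement; only one is bounded, which
  makes both definite descriptions meaningful.\<close>

lemma loop_components:
  fixes c :: "real \<Rightarrow> complex"
  assumes "simple_path c" "pathfinish c = pathstart c"
  shows "inner_comp (path_image c) = inside (path_image c)" "outer_comp (path_image c) = outside (path_image c)"
    "components (- path_image c) = {inside (path_image c), outside (path_image c)}"
proof -
  note J = Jordan_inside_outside[OF assms]
  let ?C = "path_image c"
  have comp: "X \<in> components (- ?C)" if X: "X = inside ?C \<or> X = outside ?C" for X
  proof -
    have sub: "X \<noteq> {}" "connected X" "frontier X = ?C" using X J by auto
    have "X \<subseteq> - ?C" using X J by blast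
    have "E = X" if E: "X \<subseteq> E" "E \<subseteq> - ?C" "connected E" for E
    proof (rule ccontr)
      assume "E \<noteq> X"
      then have "E \<inter> frontier X \<noteq> {}"
        using E sub(1) by (intro connected_Int_frontier) auto
      then show False using sub(3) E by auto
    qed
    then show ?thesis unfolding in_components_maximal using sub \<open>X \<subseteq> - ?C\<close> by blast
  qed
  have "X = inside ?C \<or> X = outside ?C" if X: "X \<in> components (- ?C)" for X
  proof -
    have "X \<noteq> {}" using X by (rule in_components_nonempty)
    moreover have "X \<subseteq> inside ?C \<union> outside ?C"
      using in_components_subset[OF X] by (simp only: J)
    ultimately have "X \<inter> inside ?C \<noteq> {} \<or> X \<inter> outside ?C \<noteq> {}" by blast
    then show ?thesis
      using components_eq[OF X comp[of "inside ?C"]] components_eq[OF X comp[of "outside ?C"]] by argo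
  qed
  with comp show *: "components (- ?C) = {inside ?C, outside ?C}" by blast
  have "bounded (inside ?C)" "\<not> bounded (outside ?C)" using J by auto
  then show "inner_comp ?C = inside ?C" "outer_comp ?C = outside ?C"
    unfolding inner_comp_def outer_comp_def * by (auto intro!: the_equality)
qed

section \<open>Accessibility and the final assembly\<close>

context distance_component
begin

lemma frontier_near_point:
  assumes "p \<in> frontier D"
  obtains a where "a \<in> K" "dist p a = e"
  using infdist_attains_inf[OF compact_imp_closed[OF compact_K] nonempty_K, of p] frontier_infdist[OF assms] by metis

lemma segment_to_near_point:
  assumes "dist p a = e" "a \<in> K"
  shows "closed_segment p a \<subseteq> {z. infdist z K < e} \<union> {p}"
proof
  fix z assume z: "z \<in> closed_segment p a"
  show "z \<in> {z. infdist z K < e} \<union> {p}"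
  proof (cases "z = p")
    case False
    then have "dist z a < dist p a"
      using z dist_in_closed_segment[of z p a] 
      by (metis between_mem_segment between dist_commute dist_nz less_add_same_cancel2)
    then show ?thesis using assms unfolding infdist_iff by auto
  qed auto
qed

text \<open>Follow a radius from \<open>p\<close> to a nearest point in \<open>K\<close>, cross the
  open connected neighbourhood, and come back to \<open>q\<close> along a radius.\<close>

lemma frontier_accessible:
  assumes "connected {z. infdist z K < e}" "p \<in> frontier D" "q \<in> frontier D"
  shows "\<exists>h. path h \<and> pathstart h = p \<and> pathfinish h = q \<and> path_image h \<subseteq> {z. infdist z K < e} \<union> {p, q}"
proof -
  let ?U = "{z. infdist z K < e}"
  obtain a b where ab: "a \<in> K" "dist p a = e" "b \<in> K" "dist q b = e"
    using frontier_near_point[OF assms(2)] frontier_near_point[OF assms(3)] by metis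
  have "open ?U" by (intro open_Collect_less continuous_intros)
  then have "path_connected ?U" using assms(1) by (simp add: connected_open_path_connected)
  moreover have "a \<in> ?U" "b \<in> ?U" using ab e_pos by auto
  ultimately obtain h where h: "path h" "path_image h \<subseteq> ?U" "pathstart h = a" "pathfinish h = b"
    unfolding path_connected_def by blast
  let ?h = "(linepath p a +++ h) +++ linepath b q"
  have "path_image ?h \<subseteq> closed_segment p a \<union> path_image h \<union> closed_segment q b"
    using h by (simp add: path_image_join closed_segment_commute)
  also have "\<dots> \<subseteq> ?U \<union> {p, q}"
    using h(2) segment_to_near_point[OF ab(2,1)] segment_to_near_point[OF ab(4,3)] by blast
  finally show ?thesis using h by (intro exI[of _ ?h]) auto
qed

lemma common_boundary_frontier:
  assumes "connected {z. infdist z K < e}"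
  shows "common_boundary D {z. infdist z K < e} (frontier D)"
proof
  let ?U = "{z. infdist z K < e}"
  show "connected D" by (rule connected_D)
  show "D \<noteq> {}" using component in_components_nonempty by blast
  show "D \<inter> frontier D = {}" using open_D by (simp add: frontier_def interior_open)
  show "connected ?U" by fact
  obtain b where "b \<in> K" using nonempty_K by blast
  then have "b \<in> ?U" using e_pos by simp
  then show "?U \<noteq> {}" by blast
  show "?U \<inter> frontier D = {}" using frontier_infdist by force
  \<comment> \<open>The frontier is bounded even when \<open>D\<close> is not, as it lies in the
    closed neighbourhood of the compact set \<open>K\<close>.\<close>
  have "bounded {z. infdist z K \<le> e}"
    using compact_infdist_le[OF nonempty_K compact_K e_pos] compact_imp_bounded by blast
  moreover have "frontier D \<subseteq> {z. infdist z K \<le> e}" using frontier_infdist by force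
  ultimately show "compact (frontier D)"
    by (meson bounded_subset compact_eq_bounded_closed frontier_closed)
  show "frontier D \<subseteq> closure D" by (simp add: frontier_def)
  show "frontier D \<subseteq> closure ?U"
  proof
    fix p assume p: "p \<in> frontier D"
    obtain a where a: "a \<in> K" "dist p a = e"
      using frontier_near_point[OF p] by blast
    have "open_segment p a \<subseteq> ?U"
      using segment_to_near_point[OF a(2,1)] by (auto simp: open_segment_def)
    then have "closure (open_segment p a) \<subseteq> closure ?U" by (rule closure_mono)
    then show "p \<in> closure ?U" using a e_pos by (auto simp: closure_open_segment)
  qed
  show "\<not> connected_component (- frontier D) d u" if du: "d \<in> D" "u \<in> ?U" for d u
  proof
    assume "connected_component (- frontier D) d u"
    then obtain T where T: "connected T" "T \<subseteq> - frontier D" "d \<in> T" "u \<in> T"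
      unfolding connected_component_def by blast
    have "u \<notin> D" using D_far[of u] du(2) by auto
    then have "T \<inter> frontier D \<noteq> {}"
      using T du by (intro connected_Int_frontier) auto
    then show False using T(2) by blast
  qed
qed

end

theorem theorem1:
  fixes e :: real and A D :: "complex set"
  assumes "e > 0" and "A \<noteq> {}" and "bounded A"
    and "delta_chained (2 * e) A"
    and "D \<in> components (- nbhd_closed e A)"
  shows "simple_closed_curve (frontier D)
       \<and> frontier D \<subseteq> eps_boundary e A
       \<and> (bounded D \<longrightarrow> D = inner_comp (frontier D))
       \<and> (\<not> bounded D \<longrightarrow> D = outer_comp (frontier D))"
proof -
  let ?K = "closure A"
  have "- nbhd_closed e A = {z. e < infdist z ?K}"
    by (auto simp: nbhd_closed_def infdist_closure)
  then interpret distance_component ?K e D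
    using assms by unfold_locales (auto simp: compact_closure)
  \<comment> \<open>The chain lives in \<open>A\<close>, while the local analysis uses its closure;
    both have the same open neighbourhood.\<close>
  have "{z. infdist z ?K < e} = (\<Union>a\<in>A. ball a e)"
  proof (intro set_eqI iffI)
    fix z assume "z \<in> {z. infdist z ?K < e}"
    then have "infdist z A < e" by (simp add: infdist_closure)
    then obtain a where "a \<in> A" "dist z a < e"
      using \<open>A \<noteq> {}\<close> cInf_lessD[of "dist z ` A" e] by (auto simp: infdist_notempty)
    then show "z \<in> (\<Union>a\<in>A. ball a e)" by (auto simp: dist_commute)
  next
    fix z assume "z \<in> (\<Union>a\<in>A. ball a e)"
    then obtain a where "a \<in> A" "dist z a < e" by (auto simp: dist_commute)
    then show "z \<in> {z. infdist z ?K < e}"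
      using infdist_le[of a A z] by (simp add: infdist_closure)
  qed
  then have conn: "connected {z. infdist z ?K < e}"
    using connected_chained_balls[OF assms(4,1)] by simp
  interpret common_boundary D "{z. infdist z ?K < e}" "frontier D"
    using common_boundary_frontier[OF conn] .
  obtain c where c: "simple_path c" "pathfinish c = pathstart c" "path_image c = frontier D"
    using S_is_Jordan_curve[OF locally_path_connected_frontier frontier_accessible[OF conn]] by blast
  \<comment> \<open>A connected set properly containing \<open>D\<close> meets its frontier. So
    \<open>D\<close> is the inside or the outside of the curve, and boundedness decides
    which.\<close>
  have "D \<in> components (- frontier D)"
    unfolding in_components_maximal
  proof (intro conjI allI impI)
    fix E assume E: "E \<noteq> {} \<and> D \<subseteq> E \<and> E \<subseteq> - frontier D \<and> connected E"
    show "E = D"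
    proof (rule ccontr)
      assume "E \<noteq> D"
      then have "E \<inter> frontier D \<noteq> {}"
        using E nonempty_D by (intro connected_Int_frontier) auto
      then show False using E by blast
    qed
  qed (use nonempty_D connected_D disjoint_D in auto)
  then have "D = inner_comp (frontier D) \<and> bounded D \<or> D = outer_comp (frontier D) \<and> \<not> bounded D"
    using loop_components[OF c(1,2)] Jordan_inside_outside[OF c(1,2)] unfolding c(3) by auto
  moreover have "simple_closed_curve (frontier D)"
    unfolding simple_closed_curve_def c(3)[symmetric]
    using homeomorphic_simple_path_image_circle[OF c(1,2)] by simp
  moreover have "frontier D \<subseteq> eps_boundary e A"
    using frontier_infdist by (auto simp: eps_boundary_def infdist_closure)
  ultimately show ?thesis by blast
qed

end
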